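(* Let $\eta$ be an uncountable regular cardinal. If there is a cardinal $\kappa\ge\eta$ that is tall with closure ${<}\eta$, then $\mathrm{SULST}(\mathcal L_{\eta,\eta})$ exists and is at most $\kappa$. In particular, if $\kappa$ is tall, then $\mathrm{SULST}(\mathcal L_{\kappa,\kappa})=\mathrm{ULST}(\mathcal L_{\kappa,\kappa})=\kappa$.
   Context: $\mathcal L_{\eta,\eta}$ is the infinitary logic with conjunctions/disjunctions of fewer than $\eta$ formulas and quantification over fewer than $\eta$ variables. A cardinal $\kappa$ is tall with closure ${<}\lambda$ if for every $\theta>\kappa$ there is an elementary embedding $j:V\to M$ ($M$ transitive) with critical point $\kappa$, $j(\kappa)>\theta$ and $M^{<\lambda}\subseteq M$; $\kappa$ is tall if for every $\theta>\kappa$ there is such $j$ with $M^\kappa\subseteq M$. $\mathrm{ULST}(\mathcal L)$ is the least $\delta$ such that whenever $M\models_{\mathcal L}\varphi$ is a $\tau$-structure of size $\gamma\ge\delta$ and $\bar\gamma>\gamma$, there is a $\tau$-structure $\bar M\models_{\mathcal L}\varphi$ of size $\ge\bar\gamma$ with $M$ a substructure of $\bar M$. $\mathrm{SULST}(\mathcal L)$ is the least $\delta$ such that for every $\tau$-structure $M$ of size $\gamma\ge\delta$ and every $\bar\gamma>\gamma$ there is a $\tau$-structure $\bar M$ of size $\ge\bar\gamma$ with $M\prec_{\mathcal L}\bar M$ ($M$ an $\mathcal L$-elementary substructure of $\bar M$). *)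

theory Defs
  imports Main "HOL-Library.Equipollence" "HOL-Library.Countable_Set"
begin

section \<open>The set-theoretic universe\<close>

text \<open>A type of this class is a universe V of ZFC sets, whose classes are the HOL sets over the type.
  Separation and replacement are accordingly stated for arbitrary HOL predicates and functions,
  so that they also apply to elementary embeddings of V.  The axiom of choice is not listed because
  it follows from separation and the choice operator of HOL.\<close>

class set_universe =
  fixes elts :: "'a \<Rightarrow> 'a set"
  assumes extensionality: "elts x = elts y \<Longrightarrow> x = y"
    and foundation: "wf {(x, y). x \<in> elts y}"
    and pairing: "\<exists>z. elts z = {x, y}"
    and union: "\<exists>z. elts z = (\<Union>y\<in>elts x. elts y)"
    and powerset: "\<exists>z. elts z = {y. elts y \<subseteq> elts x}"
    and infinity: "\<exists>z. (\<exists>e\<in>elts z. elts e = {}) \<and>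
                       (\<forall>x\<in>elts z. \<exists>y\<in>elts z. elts y = insert x (elts x))"
    and separation: "\<exists>z. elts z = {y \<in> elts x. P y}"
    and replacement: "\<exists>z. elts z = F ` elts x"

definition set_of :: "'v::set_universe set \<Rightarrow> 'v" where
  "set_of X = (THE x. elts x = X)"

definition kpair :: "'v::set_universe \<Rightarrow> 'v \<Rightarrow> 'v" where
  "kpair x y = set_of {set_of {x}, set_of {x, y}}"

text \<open>The graph of \<open>f\<close> restricted to \<open>\<alpha>\<close>, i.e. a sequence of length \<open>\<alpha>\<close>, as an element of V.\<close>

definition seq :: "'v::set_universe \<Rightarrow> ('v \<Rightarrow> 'v) \<Rightarrow> 'v" where
  "seq \<alpha> f = set_of ((\<lambda>\<xi>. kpair \<xi> (f \<xi>)) ` elts \<alpha>)"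

definition transitive_class :: "'v::set_universe set \<Rightarrow> bool" where
  "transitive_class N \<longleftrightarrow> (\<forall>x\<in>N. elts x \<subseteq> N)"

definition is_Ord :: "'v::set_universe \<Rightarrow> bool" where
  "is_Ord \<alpha> \<longleftrightarrow> transitive_class (elts \<alpha>) \<and> (\<forall>\<beta>\<in>elts \<alpha>. transitive_class (elts \<beta>))"

text \<open>The order on ordinals: \<open>\<alpha> < \<beta>\<close> is \<open>\<alpha> \<in> elts \<beta>\<close>, and \<open>\<alpha> \<le> \<beta>\<close> is the following.\<close>

definition ord_le :: "'v::set_universe \<Rightarrow> 'v \<Rightarrow> bool" where
  "ord_le \<alpha> \<beta> \<longleftrightarrow> \<alpha> \<in> elts \<beta> \<or> \<alpha> = \<beta>"

text \<open>Initial ordinals.  By replacement and separation, HOL bijections between sets of V are sets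
  of V, hence HOL equipollence of \<open>elts x\<close> and \<open>elts y\<close> is equipollence in V.\<close>

definition is_Card :: "'v::set_universe \<Rightarrow> bool" where
  "is_Card \<kappa> \<longleftrightarrow> is_Ord \<kappa> \<and> (\<forall>\<alpha>\<in>elts \<kappa>. \<not> elts \<alpha> \<approx> elts \<kappa>)"

definition regular_Card :: "'v::set_universe \<Rightarrow> bool" where
  "regular_Card \<eta> \<longleftrightarrow> is_Card \<eta> \<and> infinite (elts \<eta>) \<and>
     (\<forall>X \<subseteq> elts \<eta>. X \<prec> elts \<eta> \<longrightarrow> (\<exists>\<beta>\<in>elts \<eta>. X \<subseteq> elts \<beta>))"

definition has_card :: "'v::set_universe \<Rightarrow> 'v \<Rightarrow> bool" where
  "has_card x \<gamma> \<longleftrightarrow> is_Card \<gamma> \<and> elts x \<approx> elts \<gamma>"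

section \<open>Elementary embeddings and tall cardinals\<close>

datatype set_fm = SMem nat nat | SEq nat nat | SNeg set_fm | SAnd set_fm set_fm | SEx nat set_fm

primrec set_sat :: "'v::set_universe set \<Rightarrow> set_fm \<Rightarrow> (nat \<Rightarrow> 'v) \<Rightarrow> bool" where
  "set_sat N (SMem i k) s \<longleftrightarrow> s i \<in> elts (s k)"
| "set_sat N (SEq i k) s \<longleftrightarrow> s i = s k"
| "set_sat N (SNeg p) s \<longleftrightarrow> \<not> set_sat N p s"
| "set_sat N (SAnd p q) s \<longleftrightarrow> set_sat N p s \<and> set_sat N q s"
| "set_sat N (SEx i p) s \<longleftrightarrow> (\<exists>x\<in>N. set_sat N p (s(i := x)))"

definition elementary_embedding :: "('v::set_universe \<Rightarrow> 'v) \<Rightarrow> 'v set \<Rightarrow> bool" where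
  "elementary_embedding j N \<longleftrightarrow> range j \<subseteq> N \<and>
     (\<forall>p s. set_sat UNIV p s \<longleftrightarrow> set_sat N p (j \<circ> s))"

definition critical_point :: "('v::set_universe \<Rightarrow> 'v) \<Rightarrow> 'v \<Rightarrow> bool" where
  "critical_point j \<kappa> \<longleftrightarrow> is_Ord \<kappa> \<and> j \<kappa> \<noteq> \<kappa> \<and> (\<forall>\<alpha>\<in>elts \<kappa>. j \<alpha> = \<alpha>)"

text \<open>\<open>N\<^sup>\<alpha> \<subseteq> N\<close>\<close>

definition closed_seq :: "'v::set_universe set \<Rightarrow> 'v \<Rightarrow> bool" where
  "closed_seq N \<alpha> \<longleftrightarrow> (\<forall>f. f ` elts \<alpha> \<subseteq> N \<longrightarrow> seq \<alpha> f \<in> N)"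

definition tall_closure :: "'v::set_universe \<Rightarrow> 'v \<Rightarrow> bool" where
  "tall_closure \<kappa> l \<longleftrightarrow> is_Card \<kappa> \<and>
     (\<forall>\<theta>. is_Ord \<theta> \<and> \<kappa> \<in> elts \<theta> \<longrightarrow>
       (\<exists>j N. transitive_class N \<and> elementary_embedding j N \<and> critical_point j \<kappa> \<and>
              \<theta> \<in> elts (j \<kappa>) \<and> (\<forall>\<alpha>\<in>elts l. closed_seq N \<alpha>)))"

definition tall :: "'v::set_universe \<Rightarrow> bool" where
  "tall \<kappa> \<longleftrightarrow> is_Card \<kappa> \<and>
     (\<forall>\<theta>. is_Ord \<theta> \<and> \<kappa> \<in> elts \<theta> \<longrightarrow>
       (\<exists>j N. transitive_class N \<and> elementary_embedding j N \<and> critical_point j \<kappa> \<and>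
              \<theta> \<in> elts (j \<kappa>) \<and> closed_seq N \<kappa>))"

section \<open>Vocabularies and structures\<close>

text \<open>Vocabularies are arbitrary sets of finitary relation and function symbols; constants are
  function symbols of arity 0.\<close>

record 'v vocab =
  rel_syms :: 'v
  fun_syms :: 'v
  rel_arity :: "'v \<Rightarrow> nat"
  fun_arity :: "'v \<Rightarrow> nat"

record 'v struct =
  dom_of :: 'v
  rel_int :: "'v \<Rightarrow> 'v list \<Rightarrow> bool"
  fun_int :: "'v \<Rightarrow> 'v list \<Rightarrow> 'v"

definition tuples :: "'v::set_universe struct \<Rightarrow> nat \<Rightarrow> 'v list set" where
  "tuples M n = {xs. length xs = n \<and> set xs \<subseteq> elts (dom_of M)}"

definition is_structure :: "'v::set_universe vocab \<Rightarrow> 'v struct \<Rightarrow> bool" where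
  "is_structure \<tau> M \<longleftrightarrow> elts (dom_of M) \<noteq> {} \<and>
     (\<forall>f\<in>elts (fun_syms \<tau>). \<forall>xs\<in>tuples M (fun_arity \<tau> f). fun_int M f xs \<in> elts (dom_of M))"

definition substructure :: "'v::set_universe vocab \<Rightarrow> 'v struct \<Rightarrow> 'v struct \<Rightarrow> bool" where
  "substructure \<tau> M M' \<longleftrightarrow> elts (dom_of M) \<subseteq> elts (dom_of M') \<and>
     (\<forall>R\<in>elts (rel_syms \<tau>). \<forall>xs\<in>tuples M (rel_arity \<tau> R). rel_int M R xs = rel_int M' R xs) \<and>
     (\<forall>f\<in>elts (fun_syms \<tau>). \<forall>xs\<in>tuples M (fun_arity \<tau> f). fun_int M f xs = fun_int M' f xs)"

section \<open>The infinitary logics\<close>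

text \<open>Variables and symbols are elements of V.  \<open>Conj I F\<close> is the conjunction of the formulas \<open>F i\<close>
  for \<open>i \<in> elts I\<close> (values of \<open>F\<close> elsewhere play no role), and \<open>Ex X p\<close> quantifies existentially
  over all variables in \<open>elts X\<close>.  Disjunctions and universal quantifiers are obtained by negation.\<close>

datatype 'v tm = Var 'v | App 'v "'v tm list"

datatype 'v fm =
  Eq "'v tm" "'v tm"
| Rel 'v "'v tm list"
| Neg "'v fm"
| Conj 'v "'v \<Rightarrow> 'v fm"
| Ex 'v "'v fm"

primrec wf_tm :: "'v::set_universe vocab \<Rightarrow> 'v tm \<Rightarrow> bool" where
  "wf_tm \<tau> (Var x) \<longleftrightarrow> True"
| "wf_tm \<tau> (App f ts) \<longleftrightarrow> f \<in> elts (fun_syms \<tau>) \<and> length ts = fun_arity \<tau> f \<and>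
     list_all (\<lambda>b. b) (map (wf_tm \<tau>) ts)"

text \<open>\<open>in_logic \<eta> \<tau> p\<close>: \<open>p\<close> is an \<open>L\<^bsub>\<eta>,\<eta>\<^esub>\<close>-formula in the vocabulary \<open>\<tau>\<close>.\<close>

primrec in_logic :: "'v::set_universe \<Rightarrow> 'v vocab \<Rightarrow> 'v fm \<Rightarrow> bool" where
  "in_logic \<eta> \<tau> (Eq t u) \<longleftrightarrow> wf_tm \<tau> t \<and> wf_tm \<tau> u"
| "in_logic \<eta> \<tau> (Rel R ts) \<longleftrightarrow> R \<in> elts (rel_syms \<tau>) \<and> length ts = rel_arity \<tau> R \<and>
     (\<forall>t\<in>set ts. wf_tm \<tau> t)"
| "in_logic \<eta> \<tau> (Neg p) \<longleftrightarrow> in_logic \<eta> \<tau> p"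
| "in_logic \<eta> \<tau> (Conj I F) \<longleftrightarrow> elts I \<prec> elts \<eta> \<and> (\<forall>i\<in>elts I. in_logic \<eta> \<tau> (F i))"
| "in_logic \<eta> \<tau> (Ex X p) \<longleftrightarrow> elts X \<prec> elts \<eta> \<and> in_logic \<eta> \<tau> p"

primrec fv_tm :: "'v tm \<Rightarrow> 'v set" where
  "fv_tm (Var x) = {x}"
| "fv_tm (App f ts) = \<Union> (set (map fv_tm ts))"

primrec fv :: "'v::set_universe fm \<Rightarrow> 'v set" where
  "fv (Eq t u) = fv_tm t \<union> fv_tm u"
| "fv (Rel R ts) = (\<Union>t\<in>set ts. fv_tm t)"
| "fv (Neg p) = fv p"
| "fv (Conj I F) = (\<Union>i\<in>elts I. fv (F i))"
| "fv (Ex X p) = fv p - elts X"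

primrec val :: "'v struct \<Rightarrow> ('v \<Rightarrow> 'v) \<Rightarrow> 'v tm \<Rightarrow> 'v" where
  "val M s (Var x) = s x"
| "val M s (App f ts) = fun_int M f (map (val M s) ts)"

primrec sat :: "'v::set_universe struct \<Rightarrow> 'v fm \<Rightarrow> ('v \<Rightarrow> 'v) \<Rightarrow> bool" where
  "sat M (Eq t u) s \<longleftrightarrow> val M s t = val M s u"
| "sat M (Rel R ts) s \<longleftrightarrow> rel_int M R (map (val M s) ts)"
| "sat M (Neg p) s \<longleftrightarrow> \<not> sat M p s"
| "sat M (Conj I F) s \<longleftrightarrow> (\<forall>i\<in>elts I. sat M (F i) s)"
| "sat M (Ex X p) s \<longleftrightarrow>
     (\<exists>s'. (\<forall>x\<in>elts X. s' x \<in> elts (dom_of M)) \<and> (\<forall>x. x \<notin> elts X \<longrightarrow> s' x = s x) \<and> sat M p s')"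

definition models :: "'v::set_universe struct \<Rightarrow> 'v fm \<Rightarrow> bool" where
  "models M p \<longleftrightarrow> (\<forall>s. range s \<subseteq> elts (dom_of M) \<longrightarrow> sat M p s)"

definition elem_substructure ::
    "'v::set_universe \<Rightarrow> 'v vocab \<Rightarrow> 'v struct \<Rightarrow> 'v struct \<Rightarrow> bool" where
  "elem_substructure \<eta> \<tau> M M' \<longleftrightarrow> substructure \<tau> M M' \<and>
     (\<forall>p s. in_logic \<eta> \<tau> p \<and> range s \<subseteq> elts (dom_of M) \<longrightarrow> (sat M p s \<longleftrightarrow> sat M' p s))"

section \<open>Upward Loewenheim-Skolem-Tarski numbers\<close>

definition ULST_property :: "'v::set_universe \<Rightarrow> 'v \<Rightarrow> bool" where
  "ULST_property \<eta> \<delta> \<longleftrightarrow> is_Card \<delta> \<and>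
     (\<forall>\<tau> M p \<gamma> \<gamma>'.
        is_structure \<tau> M \<and> in_logic \<eta> \<tau> p \<and> fv p = {} \<and> models M p \<and>
        has_card (dom_of M) \<gamma> \<and> ord_le \<delta> \<gamma> \<and> is_Card \<gamma>' \<and> \<gamma> \<in> elts \<gamma>' \<longrightarrow>
        (\<exists>M' \<mu>. is_structure \<tau> M' \<and> models M' p \<and>
                has_card (dom_of M') \<mu> \<and> ord_le \<gamma>' \<mu> \<and> substructure \<tau> M M'))"

definition SULST_property :: "'v::set_universe \<Rightarrow> 'v \<Rightarrow> bool" where
  "SULST_property \<eta> \<delta> \<longleftrightarrow> is_Card \<delta> \<and>
     (\<forall>\<tau> M \<gamma> \<gamma>'.
        is_structure \<tau> M \<and>
        has_card (dom_of M) \<gamma> \<and> ord_le \<delta> \<gamma> \<and> is_Card \<gamma>' \<and> \<gamma> \<in> elts \<gamma>' \<longrightarrow>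
        (\<exists>M' \<mu>. is_structure \<tau> M' \<and>
                has_card (dom_of M') \<mu> \<and> ord_le \<gamma>' \<mu> \<and> elem_substructure \<eta> \<tau> M M'))"

text \<open>\<open>is_ULST \<eta> \<delta>\<close>: the number \<open>ULST(L\<^bsub>\<eta>,\<eta>\<^esub>)\<close> exists and equals \<open>\<delta>\<close>; similarly \<open>is_SULST\<close>.\<close>

definition is_ULST :: "'v::set_universe \<Rightarrow> 'v \<Rightarrow> bool" where
  "is_ULST \<eta> \<delta> \<longleftrightarrow> ULST_property \<eta> \<delta> \<and> (\<forall>\<delta>'. ULST_property \<eta> \<delta>' \<longrightarrow> ord_le \<delta> \<delta>')"

definition is_SULST :: "'v::set_universe \<Rightarrow> 'v \<Rightarrow> bool" where
  "is_SULST \<eta> \<delta> \<longleftrightarrow> SULST_property \<eta> \<delta> \<and> (\<forall>\<delta>'. SULST_property \<eta> \<delta>' \<longrightarrow> ord_le \<delta> \<delta>')"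

end

theory Submission imports Defs begin

text \<open>Let \<open>j : V \<rightarrow> N\<close> be elementary with critical point \<open>\<kappa>\<close>, let \<open>N\<close> be closed under
  sequences of length less than \<open>\<eta> \<le> \<kappa>\<close>, and let \<open>M\<close> be a structure of size \<open>\<gamma> \<ge> \<kappa>\<close>. Then
  \<open>j\<close> restricted to \<open>M\<close> is an elementary embedding of \<open>M\<close> into \<open>j(M)\<close> for the logic with
  parameter \<open>\<eta>\<close>. Satisfaction need not be internalised for this: since \<open>\<eta>\<close> is regular, the
  assignments to the variables of a formula can be taken to be functions from some \<open>\<beta> < \<eta>\<close> to
  \<open>M\<close>, and by induction on the formula \<open>j\<close> maps the set of satisfying assignments in \<open>M\<close> to the
  set of satisfying assignments in \<open>j(M)\<close>. The closure of \<open>N\<close> enters because all functions from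
  \<open>\<beta>\<close> to \<open>j(M)\<close> must belong to \<open>N\<close>, and \<open>\<eta> \<le> \<kappa>\<close> makes \<open>j\<close> commute with conjunctions of
  fewer than \<open>\<eta>\<close> formulas. Moreover \<open>j(M)\<close> has size \<open>|j(\<gamma>)|\<close>, which exceeds any given cardinal
  as \<open>j(\<gamma>) \<ge> j(\<kappa>)\<close>. If \<open>\<kappa>\<close> is tall it is regular, so this applies with \<open>\<eta> = \<kappa>\<close>.\<close>

section \<open>Sets\<close>

text \<open>\<open>set_of\<close> is a definite description, so it names the intended set only for a
  collection that forms a set of V; smallness is the side condition of every such use.\<close>

definition small :: "'v::set_universe set \<Rightarrow> bool" where
  "small X \<longleftrightarrow> (\<exists>z. elts z = X)"

lemma elts_set_of: "small X \<Longrightarrow> elts (set_of X) = X"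
  unfolding small_def set_of_def by (metis (mono_tags, lifting) extensionality theI')

lemma set_of_elts: "set_of (elts x) = x"
  by (rule extensionality, rule elts_set_of) (auto simp: small_def)

lemma small_elts: "small (elts x)"
  by (auto simp: small_def)

lemma small_subset:
  assumes "small X" "Y \<subseteq> X" shows "small Y"
proof -
  obtain x where "elts x = X" using assms by (auto simp: small_def)
  moreover obtain z where "elts z = {y \<in> elts x. y \<in> Y}"
    using separation[of x "\<lambda>y. y \<in> Y"] by blast
  ultimately have "elts z = Y" using assms by blast
  then show ?thesis by (auto simp: small_def)
qed

lemma small_image: "small X \<Longrightarrow> small ((F :: 'v::set_universe \<Rightarrow> 'v) ` X)"
  unfolding small_def using replacement by blast

lemma small_Union: "small X \<Longrightarrow> small (\<Union>y\<in>X. elts y)"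
  unfolding small_def using union by metis

lemma small_UN:
  fixes I :: "'v::set_universe set"
  assumes "small I" "\<And>i. i \<in> I \<Longrightarrow> small (B i :: 'v set)" shows "small (\<Union>i\<in>I. B i)"
proof -
  have "small (\<Union>y\<in>(\<lambda>i. set_of (B i)) ` I. elts y)"
    by (intro small_Union small_image assms)
  then show ?thesis using assms by (simp add: elts_set_of)
qed

lemma small_pair: "small {x, y}"
  unfolding small_def using pairing by metis

lemma small_empty: "small {}"
  using small_subset[OF small_pair] by blast

lemma small_Un:
  assumes "small X" "small Y" shows "small (X \<union> Y)"
  using small_Union[OF small_pair[of "set_of X" "set_of Y"]] assms by (simp add: elts_set_of)

lemma small_insert: "small X \<Longrightarrow> small (insert x X)"
  using small_Un[OF small_pair[of x x], of X] by simp

lemma small_Pow: "small {y. elts y \<subseteq> elts x}"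
  unfolding small_def using powerset by metis

lemmas elts_set_of_simps [simp] =
  elts_set_of[OF small_empty] elts_set_of[OF small_insert[OF small_empty]]
  elts_set_of[OF small_pair] set_of_elts

lemma kpair_eq_iff [simp]: "kpair a b = kpair c d \<longleftrightarrow> a = c \<and> b = d"
proof
  assume "kpair a b = kpair c d"
  then have "elts (kpair a b) = elts (kpair c d)" by simp
  then have *: "{set_of {a}, set_of {a, b}} = {set_of {c}, set_of {c, d}}"
    by (simp add: kpair_def)
  have "elts ` {set_of {a}, set_of {a, b}} = elts ` {set_of {c}, set_of {c, d}}"
    by (simp only: *)
  then have "{{a}, {a, b}} = {{c}, {c, d}}" by simp
  then show "a = c \<and> b = d" by (auto simp: doubleton_eq_iff)
qed simp

definition prod_set :: "'v::set_universe \<Rightarrow> 'v \<Rightarrow> 'v" where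
  "prod_set x y = set_of (\<Union>a\<in>elts x. kpair a ` elts y)"

lemma elts_prod_set: "elts (prod_set x y) = (\<Union>a\<in>elts x. kpair a ` elts y)"
  unfolding prod_set_def by (intro elts_set_of small_UN small_image small_elts)

definition graph :: "'v::set_universe \<Rightarrow> ('v \<Rightarrow> 'v) \<Rightarrow> 'v" where
  "graph x h = set_of ((\<lambda>a. kpair a (h a)) ` elts x)"

lemma elts_graph: "elts (graph x h) = (\<lambda>a. kpair a (h a)) ` elts x"
  unfolding graph_def by (intro elts_set_of small_image small_elts)

lemma kpair_in_graph [simp]: "kpair a b \<in> elts (graph x h) \<longleftrightarrow> a \<in> elts x \<and> b = h a"
  by (auto simp: elts_graph)

definition sep :: "'v::set_universe \<Rightarrow> ('v \<Rightarrow> bool) \<Rightarrow> 'v" where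
  "sep x P = set_of {a \<in> elts x. P a}"

lemma elts_sep [simp]: "elts (sep x P) = {a \<in> elts x. P a}"
  unfolding sep_def by (intro elts_set_of small_subset[OF small_elts[of x]]) auto

definition image_set :: "('v::set_universe \<Rightarrow> 'v) \<Rightarrow> 'v \<Rightarrow> 'v" where
  "image_set h x = set_of (h ` elts x)"

lemma elts_image_set [simp]: "elts (image_set h x) = h ` elts x"
  unfolding image_set_def by (intro elts_set_of small_image small_elts)

section \<open>Ordinals\<close>

lemma mem_not_refl: "x \<notin> elts (x :: 'v::set_universe)"
  using foundation[where 'a='v] by (metis case_prodI mem_Collect_eq wf_not_refl)

lemma elts_induct:
  fixes x :: "'v::set_universe"
  assumes "\<And>x. (\<And>y. y \<in> elts x \<Longrightarrow> P y) \<Longrightarrow> P x" shows "P x"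
  using wf_induct_rule[OF foundation[where 'a='v], of P x] assms by blast

lemma is_Ord_mem: "is_Ord a \<Longrightarrow> b \<in> elts a \<Longrightarrow> is_Ord b"
  unfolding is_Ord_def transitive_class_def by blast

lemma is_Ord_trans: "is_Ord a \<Longrightarrow> b \<in> elts a \<Longrightarrow> c \<in> elts b \<Longrightarrow> c \<in> elts a"
  unfolding is_Ord_def transitive_class_def by blast

lemma is_Ord_linear:
  assumes "is_Ord a" "is_Ord b" shows "a \<in> elts b \<or> a = b \<or> b \<in> elts a"
  using assms
proof (induction a arbitrary: b rule: elts_induct)
  case (1 a)
  note IHa = 1
  from 1(3) show ?case
  proof (induction b rule: elts_induct)
    case (1 b)
    show ?case
    proof (rule ccontr)
      assume neg: "\<not> ?thesis"
      \<comment> \<open>By the outer hypothesis \<open>x\<close> is comparable with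
        \<open>b\<close>, and \<open>x = b\<close> or \<open>b \<in> elts x\<close> would put
        \<open>b\<close> into \<open>a\<close>.\<close>
      have "x \<in> elts b" if "x \<in> elts a" for x
        using IHa(1)[OF that is_Ord_mem[OF IHa(2) that] 1(2)] neg that is_Ord_trans IHa(2) by blast
      moreover have "x \<in> elts a" if "x \<in> elts b" for x
        using 1(1)[OF that is_Ord_mem[OF 1(2) that]] neg that is_Ord_trans 1(2) by blast
      ultimately have "a = b" by (intro extensionality) blast
      then show False using neg by blast
    qed
  qed
qed

lemma ord_le_subset: "is_Ord b \<Longrightarrow> ord_le a b \<Longrightarrow> elts a \<subseteq> elts b"
  unfolding ord_le_def using is_Ord_trans by blast

lemma subset_ord_le: "is_Ord a \<Longrightarrow> is_Ord b \<Longrightarrow> elts a \<subseteq> elts b \<Longrightarrow> ord_le a b"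
  unfolding ord_le_def using is_Ord_linear mem_not_refl by blast

lemma is_Card_Ord: "is_Card a \<Longrightarrow> is_Ord a"
  by (simp add: is_Card_def)

lemma least_elt:
  fixes x :: "'v::set_universe"
  assumes "P x" shows "\<exists>y. P y \<and> (\<forall>z\<in>elts y. \<not> P z)"
proof (rule ccontr)
  assume "\<not> ?thesis"
  then have "\<not> P y" for y by (induction y rule: elts_induct) blast
  then show False using assms by blast
qed

lemma Ord_has_card:
  fixes a :: "'v::set_universe"
  assumes "is_Ord a" shows "\<exists>c. has_card a c"
proof -
  have "is_Ord a \<and> elts a \<approx> elts a" using assms by simp
  from least_elt[of "\<lambda>c::'v. is_Ord c \<and> elts a \<approx> elts c", OF this]
  obtain c :: 'v where c: "is_Ord c \<and> elts a \<approx> elts c" "\<forall>z\<in>elts c. \<not> (is_Ord z \<and> elts a \<approx> elts z)" by blast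
  have "is_Card c" unfolding is_Card_def
    using c is_Ord_mem eqpoll_trans eqpoll_sym by metis
  then show ?thesis using c by (auto simp: has_card_def)
qed

lemma Card_mem_lesspoll:
  assumes "is_Card c" "a \<in> elts c" shows "elts a \<prec> elts c"
proof -
  have "elts a \<subseteq> elts c" using assms is_Ord_trans is_Card_Ord by blast
  then show ?thesis using assms unfolding is_Card_def lesspoll_def
    using subset_imp_lepoll by blast
qed

lemma Card_le_of_lepoll:
  assumes "is_Card c" "is_Ord d" "elts c \<lesssim> elts d" shows "ord_le c d"
  using is_Ord_linear[OF is_Card_Ord[OF assms(1)] assms(2)] Card_mem_lesspoll[OF assms(1), of d] assms(3)
    lesspoll_trans1 lesspoll_not_refl unfolding ord_le_def by blast

lemma is_Ord_succ:
  assumes "is_Ord a" shows "\<exists>b. is_Ord b \<and> a \<in> elts b"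
proof -
  have "elts (set_of (insert a (elts a))) = insert a (elts a)"
    by (intro elts_set_of small_insert small_elts)
  then have "is_Ord (set_of (insert a (elts a)))" "a \<in> elts (set_of (insert a (elts a)))"
    using assms unfolding is_Ord_def transitive_class_def by auto
  then show ?thesis by blast
qed

lemma lepoll_linear: "A \<lesssim> B \<or> B \<lesssim> A"
  unfolding lepoll_def card_of_ordLeq by (rule ordLeq_total) (rule card_of_Well_order)+

text \<open>The product embeds into the square of the larger factor, and an infinite set is
  equipollent to its square.\<close>

lemma lesspoll_Times_infinite:
  assumes C: "infinite C" and X: "X \<prec> C" and Y: "Y \<prec> C" shows "X \<times> Y \<prec> C"
proof -
  have square: "Z \<times> Z \<prec> C" if "Z \<prec> C" for Z :: "'z set"
  proof (cases "finite Z")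
    case True
    then show ?thesis using C by (intro finite_lesspoll_infinite) auto
  next
    case False
    then have "Z \<times> Z \<approx> Z"
      unfolding eqpoll_iff_card_of_ordIso by (rule card_of_Times_same_infinite)
    then show ?thesis using that eq_lesspoll_trans by blast
  qed
  show ?thesis
    using lepoll_linear[of X Y]
  proof
    assume "X \<lesssim> Y"
    then have "X \<times> Y \<lesssim> Y \<times> Y" by (rule times_lepoll_mono) simp
    then show ?thesis using square[OF Y] lesspoll_trans1 by blast
  next
    assume "Y \<lesssim> X"
    then have "X \<times> Y \<lesssim> X \<times> X" by (intro times_lepoll_mono) auto
    then show ?thesis using square[OF X] lesspoll_trans1 by blast
  qed
qed

text \<open>The subset \<open>X\<close> of \<open>\<kappa>\<close> is mapped to its order type by the Mostowski collapse.\<close>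

lemma subset_Ord_eqpoll_Ord:
  fixes \<kappa> :: "'v::set_universe"
  assumes \<kappa>: "is_Ord \<kappa>" and X: "X \<subseteq> elts \<kappa>"
  shows "\<exists>l. is_Ord l \<and> ord_le l \<kappa> \<and> X \<approx> elts l"
proof -
  \<comment> \<open>The recursion along membership sends \<open>x\<close> to the set of values at
    those members of \<open>x\<close> that lie in \<open>X\<close>; since \<open>X\<close> is a
    subset of \<kappa>, the value at \<kappa> is the order type of \<open>X\<close>.\<close>
  define g :: "'v \<Rightarrow> 'v" where "g = wfrec {(x, y). x \<in> elts y} (\<lambda>g x. set_of (g ` (elts x \<inter> X)))"
  have sm: "small (g ` (elts x \<inter> X))" for x
    by (intro small_image small_subset[OF small_elts[of x]]) blast
  have "g x = set_of (g ` (elts x \<inter> X))" for x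
    unfolding g_def by (subst wfrec[OF foundation]) (auto simp: cut_def intro!: arg_cong[of _ _ set_of] image_cong)
  then have elts_g: "elts (g x) = g ` (elts x \<inter> X)" for x
    using elts_set_of[OF sm] by metis
  \<comment> \<open>The collapse never raises an ordinal; this bounds the order type by
    \<kappa>.\<close>
  have ord: "is_Ord (g x) \<and> elts (g x) \<subseteq> elts x" if "is_Ord x" for x
    using that
  proof (induction x rule: elts_induct)
    case (1 x)
    have IH: "is_Ord (g y) \<and> elts (g y) \<subseteq> elts y" if "y \<in> elts x" for y
      using 1 that is_Ord_mem by blast
    have tr: "elts z \<subseteq> elts (g x)" if z: "z \<in> elts (g x)" for z
    proof -
      obtain y where y: "y \<in> elts x" "z = g y" using z elts_g by auto
      then have "elts y \<subseteq> elts x" using 1(2) is_Ord_trans by blast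
      then show ?thesis using y elts_g by auto
    qed
    have "is_Ord (g x)"
      unfolding is_Ord_def transitive_class_def
      using tr IH elts_g unfolding is_Ord_def transitive_class_def by auto
    moreover have "z \<in> elts x" if z: "z \<in> elts (g x)" for z
    proof -
      obtain y where y: "y \<in> elts x" "z = g y" using z elts_g by auto
      then have "ord_le z y" using IH subset_ord_le is_Ord_mem 1(2) by blast
      then show ?thesis using y 1(2) is_Ord_trans unfolding ord_le_def by blast
    qed
    ultimately show ?case by blast
  qed
  have "inj_on g X"
  proof (rule inj_onI, rule ccontr)
    fix x y assume xy: "x \<in> X" "y \<in> X" "g x = g y" "x \<noteq> y"
    then have "x \<in> elts y \<or> y \<in> elts x" using is_Ord_linear is_Ord_mem[OF \<kappa>] X by blast
    then have "g x \<in> elts (g y) \<or> g y \<in> elts (g x)" using elts_g xy(1,2) by blast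
    then show False using xy mem_not_refl by metis
  qed
  moreover have "elts (g \<kappa>) = g ` X" using elts_g X by (simp add: inf.absorb2)
  ultimately have "X \<approx> elts (g \<kappa>)" using inj_on_image_eqpoll_self eqpoll_sym by metis
  moreover have "is_Ord (g \<kappa>)" "ord_le (g \<kappa>) \<kappa>" using ord[OF \<kappa>] subset_ord_le \<kappa> by blast+
  ultimately show ?thesis by blast
qed

section \<open>Transfer of bounded formulas\<close>

primrec svars :: "set_fm \<Rightarrow> nat set" where
  "svars (SMem i k) = {i, k}"
| "svars (SEq i k) = {i, k}"
| "svars (SNeg p) = svars p"
| "svars (SAnd p q) = svars p \<union> svars q"
| "svars (SEx i p) = insert i (svars p)"

primrec sren :: "(nat \<Rightarrow> nat) \<Rightarrow> set_fm \<Rightarrow> set_fm" where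
  "sren r (SMem i k) = SMem (r i) (r k)"
| "sren r (SEq i k) = SEq (r i) (r k)"
| "sren r (SNeg p) = SNeg (sren r p)"
| "sren r (SAnd p q) = SAnd (sren r p) (sren r q)"
| "sren r (SEx i p) = SEx (r i) (sren r p)"

lemma finite_svars: "finite (svars p)"
  by (induction p) auto

lemma set_sat_cong: "(\<And>i. i \<in> svars p \<Longrightarrow> s i = t i) \<Longrightarrow> set_sat N p s = set_sat N p t"
proof (induction p arbitrary: s t)
  case (SEx i p)
  have "set_sat N p (s(i := x)) = set_sat N p (t(i := x))" for x
    using SEx.prems by (intro SEx.IH) auto
  then show ?case by simp
next
  case (SAnd p q)
  have "set_sat N p s = set_sat N p t" "set_sat N q s = set_sat N q t"
    using SAnd.prems by (intro SAnd.IH; auto)+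
  then show ?case by simp
next
  case (SNeg p)
  have "set_sat N p s = set_sat N p t"
    using SNeg.prems by (intro SNeg.IH) auto
  then show ?case by simp
qed auto

text \<open>Bound variables are renamed as well, so injectivity of \<open>r\<close> keeps an update
  of one variable from touching another.\<close>

lemma set_sat_sren: "inj r \<Longrightarrow> set_sat N (sren r p) s = set_sat N p (s \<circ> r)"
proof (induction p arbitrary: s)
  case (SEx i p)
  have "s(r i := x) \<circ> r = (s \<circ> r)(i := x)" for x
    using SEx.prems by (auto simp: fun_eq_iff inj_eq)
  then show ?case using SEx by (simp only: sren.simps set_sat.simps)
qed auto

text \<open>Formulas have named variables, whereas the rules for bounded predicates shift indices
  under a quantifier; this lemma mediates between the two conventions.\<close>

lemma set_fm_ex: "\<exists>q. \<forall>N s. set_sat N q s \<longleftrightarrow> (\<exists>x\<in>N. set_sat N p (case_nat x s))"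
proof -
  obtain K where K: "\<And>i. i \<in> svars p \<Longrightarrow> i \<le> K"
    using finite_svars finite_nat_set_iff_bounded_le by meson
  \<comment> \<open>Index 0 moves to the top index \<open>K\<close> and each of 1, ...,
    \<open>K\<close> drops by one, so \<open>s(K := x)\<close> composed with \<open>r\<close> agrees
    with \<open>case_nat x s\<close> on the variables of \<open>p\<close>.\<close>
  define r where "r n = (if n = 0 then K else if n \<le> K then n - 1 else n)" for n
  have "inj r" by (auto simp: inj_on_def r_def split: if_splits)
  have "set_sat N (sren r p) (s(K := x)) = set_sat N p (case_nat x s)"
    for N and s :: "nat \<Rightarrow> 'a::set_universe" and x
    unfolding set_sat_sren[OF \<open>inj r\<close>]
    by (intro set_sat_cong) (auto simp: r_def dest: K split: nat.splits)
  then have "set_sat N (SEx K (sren r p)) s \<longleftrightarrow> (\<exists>x\<in>N. set_sat N p (case_nat x s))"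
    for N and s :: "nat \<Rightarrow> 'a::set_universe" by simp
  then show ?thesis by blast
qed

text \<open>Predicates that are defined by a formula absolute for transitive classes.  The rules below are
  stated in de Bruijn style: under a bounded quantifier, \<open>s 0\<close> is the bound variable.\<close>

definition bounded_pred :: "((nat \<Rightarrow> 'v::set_universe) \<Rightarrow> bool) \<Rightarrow> bool" where
  "bounded_pred P \<longleftrightarrow>
     (\<exists>p. \<forall>N s. transitive_class N \<and> range s \<subseteq> N \<longrightarrow> set_sat N p s = P s)"

lemma bounded_predI:
  "(\<And>N s. transitive_class N \<Longrightarrow> range s \<subseteq> N \<Longrightarrow> set_sat N p s = P s) \<Longrightarrow> bounded_pred P"
  unfolding bounded_pred_def by blast

lemma bounded_predE:
  assumes "bounded_pred P"
  obtains p where "\<And>N s. transitive_class N \<Longrightarrow> range s \<subseteq> N \<Longrightarrow> set_sat N p s = P s"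
  using assms unfolding bounded_pred_def by blast

named_theorems bounded

lemma bounded_mem [bounded]: "bounded_pred (\<lambda>s. s i \<in> elts (s k))"
  by (rule bounded_predI[of "SMem i k"]) simp

lemma bounded_eq [bounded]: "bounded_pred (\<lambda>s. s i = s k)"
  by (rule bounded_predI[of "SEq i k"]) simp

lemma bounded_not [bounded]: "bounded_pred P \<Longrightarrow> bounded_pred (\<lambda>s. \<not> P s)"
  by (erule bounded_predE, rule bounded_predI[of "SNeg _"]) simp

lemma bounded_conj [bounded]:
  assumes "bounded_pred P" "bounded_pred Q" shows "bounded_pred (\<lambda>s. P s \<and> Q s)"
proof -
  obtain p q where "\<And>N s. transitive_class N \<Longrightarrow> range s \<subseteq> N \<Longrightarrow> set_sat N p s = P s"
    "\<And>N s. transitive_class N \<Longrightarrow> range s \<subseteq> N \<Longrightarrow> set_sat N q s = Q s"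
    using assms by (metis bounded_predE)
  then show ?thesis by (intro bounded_predI[of "SAnd p q"]) simp
qed

lemma bounded_disj [bounded]:
  assumes "bounded_pred P" "bounded_pred Q" shows "bounded_pred (\<lambda>s. P s \<or> Q s)"
  using bounded_not[OF bounded_conj[OF bounded_not[OF assms(1)] bounded_not[OF assms(2)]]] by simp

lemma bounded_imp [bounded]:
  assumes "bounded_pred P" "bounded_pred Q" shows "bounded_pred (\<lambda>s. P s \<longrightarrow> Q s)"
  using bounded_disj[OF bounded_not[OF assms(1)] assms(2)] by (simp only: imp_conv_disj)

lemma bounded_iff [bounded]:
  assumes "bounded_pred P" "bounded_pred Q" shows "bounded_pred (\<lambda>s. P s \<longleftrightarrow> Q s)"
  unfolding iff_conv_conj_imp by (intro bounded_conj bounded_imp assms)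

text \<open>Members of \<open>s i\<close> belong to the transitive class \<open>N\<close>
  automatically, so restricting the quantifier to \<open>N\<close> does not change its
  meaning.\<close>

lemma bounded_bex [bounded]:
  fixes P :: "'v::set_universe \<Rightarrow> (nat \<Rightarrow> 'v) \<Rightarrow> bool"
  assumes "bounded_pred (\<lambda>s. P (s 0) (\<lambda>n. s (Suc n)))"
  shows "bounded_pred (\<lambda>s. \<exists>x\<in>elts (s i). P x s)"
proof -
  obtain p where p: "\<And>N s. transitive_class N \<Longrightarrow> range s \<subseteq> N \<Longrightarrow>
      set_sat N p s = P (s 0) (\<lambda>n. s (Suc n))"
    using assms(1) by (rule bounded_predE) blast
  obtain q where q: "\<And>N (s :: nat \<Rightarrow> 'v). set_sat N q s \<longleftrightarrow>
      (\<exists>x\<in>N. set_sat N (SAnd (SMem 0 (Suc i)) p) (case_nat x s))"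
    using set_fm_ex by metis
  show ?thesis
  proof (rule bounded_predI)
    fix N :: "'v set" and s :: "nat \<Rightarrow> 'v"
    assume N: "transitive_class N" "range s \<subseteq> N"
    have "set_sat N p (case_nat x s) = P x s" if "x \<in> N" for x
    proof -
      have "range (case_nat x s) \<subseteq> N" using N(2) that by (force split: nat.splits)
      then show ?thesis using p[OF N(1)] by simp
    qed
    moreover have "elts (s i) \<subseteq> N" using N unfolding transitive_class_def by blast
    ultimately show "set_sat N q s = (\<exists>x\<in>elts (s i). P x s)" using q by auto
  qed
qed

lemma bounded_ball [bounded]:
  fixes P :: "'v::set_universe \<Rightarrow> (nat \<Rightarrow> 'v) \<Rightarrow> bool"
  assumes "bounded_pred (\<lambda>s. P (s 0) (\<lambda>n. s (Suc n)))"
  shows "bounded_pred (\<lambda>s. \<forall>x\<in>elts (s i). P x s)"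
  using bounded_not[OF bounded_bex[where P="\<lambda>x s. \<not> P x s", OF bounded_not[OF assms]]] by simp

text \<open>The right-hand side has only quantifiers bounded by the pair, which makes being a pair
  absolute for transitive classes; ordered pairs are treated likewise.\<close>

lemma eq_set_of_pair_iff:
  "u = set_of {x, y} \<longleftrightarrow> x \<in> elts u \<and> y \<in> elts u \<and> (\<forall>t\<in>elts u. t = x \<or> t = y)"
proof
  assume "x \<in> elts u \<and> y \<in> elts u \<and> (\<forall>t\<in>elts u. t = x \<or> t = y)"
  then have "elts u = {x, y}" by blast
  then show "u = set_of {x, y}" by (intro extensionality) simp
qed simp

lemma eq_kpair_iff:
  "z = kpair x y \<longleftrightarrow> (\<exists>u\<in>elts z. u = set_of {x, x}) \<and> (\<exists>u\<in>elts z. u = set_of {x, y}) \<and>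
     (\<forall>u\<in>elts z. u = set_of {x, x} \<or> u = set_of {x, y})"
  unfolding kpair_def eq_set_of_pair_iff[of z] by auto

lemma bounded_eq_set_of_pair [bounded]: "bounded_pred (\<lambda>s. s a = set_of {s b, s c})"
  unfolding eq_set_of_pair_iff by (intro bounded)

lemma bounded_eq_kpair [bounded]: "bounded_pred (\<lambda>s. s a = kpair (s b) (s c))"
  unfolding eq_kpair_iff by (intro bounded)

lemma bounded_kpair_mem [bounded]: "bounded_pred (\<lambda>s. kpair (s a) (s b) \<in> elts (s c))"
proof -
  have *: "kpair x y \<in> elts z \<longleftrightarrow> (\<exists>w\<in>elts z. w = kpair x y)" for x y z :: 'a by blast
  show ?thesis unfolding * by (intro bounded)
qed

section \<open>Elementary embeddings and absolute predicates\<close>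

locale embedding =
  fixes j :: "'v::set_universe \<Rightarrow> 'v" and N :: "'v set"
  assumes transitive_N: "transitive_class N" and elementary: "elementary_embedding j N"
begin

lemma j_in_N: "j x \<in> N"
  using elementary unfolding elementary_embedding_def by blast

lemma elts_j_in_N: "y \<in> elts (j x) \<Longrightarrow> y \<in> N"
  using transitive_N j_in_N unfolding transitive_class_def by blast

text \<open>The defining formula is absolute for V and for \<open>N\<close>, both transitive;
  elementarity connects the two evaluations.\<close>

lemma bounded_transfer:
  assumes "bounded_pred P" shows "P s \<longleftrightarrow> P (j \<circ> s)"
proof -
  obtain p where p: "\<And>N s. transitive_class N \<Longrightarrow> range s \<subseteq> N \<Longrightarrow> set_sat N p s = P s"
    using assms by (rule bounded_predE) blast
  have "P s \<longleftrightarrow> set_sat UNIV p s" by (subst p) (auto simp: transitive_class_def)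
  also have "\<dots> \<longleftrightarrow> set_sat N p (j \<circ> s)"
    using elementary unfolding elementary_embedding_def by blast
  also have "\<dots> \<longleftrightarrow> P (j \<circ> s)" using transitive_N j_in_N by (intro p) auto
  finally show ?thesis .
qed

text \<open>One unbounded universal quantifier is carried along too: truth for all \<open>x\<close>
  in V yields truth for all \<open>x\<close> in \<open>N\<close>, including those outside the range
  of \<open>j\<close>.\<close>

lemma bounded_transfer_all:
  fixes P :: "'v \<Rightarrow> (nat \<Rightarrow> 'v) \<Rightarrow> bool"
  assumes "bounded_pred (\<lambda>s. P (s 0) (\<lambda>n. s (Suc n)))" "\<And>x. P x s" "x \<in> N"
  shows "P x (j \<circ> s)"
proof -
  obtain p where p: "\<And>N s. transitive_class N \<Longrightarrow> range s \<subseteq> N \<Longrightarrow>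
      set_sat N p s = P (s 0) (\<lambda>n. s (Suc n))"
    using assms(1) by (rule bounded_predE) blast
  obtain q where q: "\<And>N (s :: nat \<Rightarrow> 'v). set_sat N q s \<longleftrightarrow>
      (\<exists>x\<in>N. set_sat N (SNeg p) (case_nat x s))"
    using set_fm_ex by metis
  have "set_sat UNIV p (case_nat x s)" for x
    using assms(2) by (subst p) (auto simp: transitive_class_def)
  then have "\<not> set_sat UNIV q s" using q by auto
  then have "\<not> set_sat N q (j \<circ> s)"
    using elementary unfolding elementary_embedding_def by blast
  then have "set_sat N p (case_nat x (j \<circ> s))" using q assms(3) by auto
  moreover have "range (case_nat x (j \<circ> s)) \<subseteq> N"
    using j_in_N assms(3) by (auto split: nat.splits)
  ultimately show ?thesis
    using p[OF transitive_N, of "case_nat x (j \<circ> s)"] by (simp del: o_apply)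
qed

lemma transfer2: "bounded_pred (\<lambda>s. P (s 0) (s 1)) \<Longrightarrow> P a b = P (j a) (j b)"
  \<comment> \<open>Beyond index 1 the assignment \<open>(!) [a, b]\<close> is unspecified, and
    \<open>P\<close> does not look there.\<close>
  using bounded_transfer[of "\<lambda>s. P (s 0) (s 1)" "(!) [a, b]"] by simp

lemma transfer3: "bounded_pred (\<lambda>s. P (s 0) (s 1) (s 2)) \<Longrightarrow> P a b c = P (j a) (j b) (j c)"
  using bounded_transfer[of "\<lambda>s. P (s 0) (s 1) (s 2)" "(!) [a, b, c]"] by simp

lemma transfer4: "bounded_pred (\<lambda>s. P (s 0) (s 1) (s 2) (s 3)) \<Longrightarrow>
    P a b c d = P (j a) (j b) (j c) (j d)"
  using bounded_transfer[of "\<lambda>s. P (s 0) (s 1) (s 2) (s 3)" "(!) [a, b, c, d]"] by simp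

lemma transfer7: "bounded_pred (\<lambda>s. P (s 0) (s 1) (s 2) (s 3) (s 4) (s 5) (s 6)) \<Longrightarrow>
    P a b c d e f g = P (j a) (j b) (j c) (j d) (j e) (j f) (j g)"
  using bounded_transfer[of "\<lambda>s. P (s 0) (s 1) (s 2) (s 3) (s 4) (s 5) (s 6)"
      "(!) [a, b, c, d, e, f, g]"] by simp

lemma j_mem_iff [simp]: "j x \<in> elts (j y) \<longleftrightarrow> x \<in> elts y"
  using transfer2[of "\<lambda>x y. x \<in> elts y" x y] by (simp add: bounded)

lemma j_eq_iff [simp]: "j x = j y \<longleftrightarrow> x = y"
  using transfer2[of "\<lambda>x y. x = y" x y] by (simp add: bounded)

lemma j_kpair: "j (kpair x y) = kpair (j x) (j y)"
  using transfer3[of "\<lambda>z x y. z = kpair x y" "kpair x y" x y] by (simp add: bounded)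

lemma j_subset_iff: "elts (j x) \<subseteq> elts (j y) \<longleftrightarrow> elts x \<subseteq> elts y"
proof -
  have "bounded_pred (\<lambda>s. \<forall>t\<in>elts (s 0). t \<in> elts (s 1))" by (intro bounded)
  from transfer2[of "\<lambda>x y. \<forall>t\<in>elts x. t \<in> elts y", OF this]
  show ?thesis by blast
qed

lemma j_Ord_iff: "is_Ord (j x) \<longleftrightarrow> is_Ord x"
proof -
  \<comment> \<open>The trivial equation for \<open>s 1\<close> brings a one-place predicate into
    the two-place form of \<open>transfer2\<close>.\<close>
  have "bounded_pred (\<lambda>s. (\<forall>t\<in>elts (s 0). \<forall>u\<in>elts t. u \<in> elts (s 0)) \<and>
       (\<forall>b\<in>elts (s 0). \<forall>t\<in>elts b. \<forall>u\<in>elts t. u \<in> elts b) \<and> s 1 = s 1)"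
    by (intro bounded)
  from transfer2[of "\<lambda>x y. (\<forall>t\<in>elts x. \<forall>u\<in>elts t. u \<in> elts x) \<and>
       (\<forall>b\<in>elts x. \<forall>t\<in>elts b. \<forall>u\<in>elts t. u \<in> elts b) \<and> y = y", OF this]
  have "((\<forall>t\<in>elts x. \<forall>u\<in>elts t. u \<in> elts x) \<and>
       (\<forall>b\<in>elts x. \<forall>t\<in>elts b. \<forall>u\<in>elts t. u \<in> elts b)) =
       ((\<forall>t\<in>elts (j x). \<forall>u\<in>elts t. u \<in> elts (j x)) \<and>
       (\<forall>b\<in>elts (j x). \<forall>t\<in>elts b. \<forall>u\<in>elts t. u \<in> elts b))" by simp
  then show ?thesis unfolding is_Ord_def transitive_class_def subset_eq by blast
qed

end

section \<open>Functions and tuples as elements of V\<close>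

definition fun_app :: "'v::set_universe \<Rightarrow> 'v \<Rightarrow> 'v" where
  "fun_app d \<xi> = (THE y. kpair \<xi> y \<in> elts d)"

text \<open>All quantifiers are bounded, so that the notion transfers. Uniqueness is therefore asked
  only among values in \<open>A\<close>; the clause on the members of \<open>d\<close> excludes
  other values.\<close>

definition function_set :: "'v::set_universe \<Rightarrow> 'v \<Rightarrow> 'v \<Rightarrow> bool" where
  "function_set D \<beta> A \<longleftrightarrow> (\<forall>d\<in>elts D. (\<forall>z\<in>elts d. \<exists>\<xi>\<in>elts \<beta>. \<exists>y\<in>elts A. z = kpair \<xi> y) \<and>
     (\<forall>\<xi>\<in>elts \<beta>. \<exists>y\<in>elts A. kpair \<xi> y \<in> elts d \<and> (\<forall>y'\<in>elts A. kpair \<xi> y' \<in> elts d \<longrightarrow> y' = y)))"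

text \<open>The quantifier over \<open>f\<close> is not bounded, so this does not transfer by
  elementarity alone; \<open>all_functions_j\<close> obtains it from the closure of the target
  class.\<close>

definition all_functions :: "'v::set_universe \<Rightarrow> 'v \<Rightarrow> 'v \<Rightarrow> bool" where
  "all_functions D \<beta> A \<longleftrightarrow> function_set D \<beta> A \<and>
     (\<forall>f. f ` elts \<beta> \<subseteq> elts A \<longrightarrow> (\<exists>d\<in>elts D. \<forall>\<xi>\<in>elts \<beta>. fun_app d \<xi> = f \<xi>))"

lemma
  assumes "function_set D \<beta> A" "d \<in> elts D" "\<xi> \<in> elts \<beta>"
  shows kpair_mem_iff_fun_app: "kpair \<xi> y \<in> elts d \<longleftrightarrow> y = fun_app d \<xi>"
    and fun_app_in: "fun_app d \<xi> \<in> elts A"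
proof -
  obtain y0 where y0: "y0 \<in> elts A" "kpair \<xi> y0 \<in> elts d"
    "\<And>y'. y' \<in> elts A \<Longrightarrow> kpair \<xi> y' \<in> elts d \<Longrightarrow> y' = y0"
    using assms unfolding function_set_def by meson
  have "y \<in> elts A" if "kpair \<xi> y \<in> elts d" for y
    using assms that unfolding function_set_def by fastforce
  then have iff: "kpair \<xi> y \<in> elts d \<longleftrightarrow> y = y0" for y using y0 by blast
  then have "fun_app d \<xi> = y0" unfolding fun_app_def by simp
  then show "kpair \<xi> y \<in> elts d \<longleftrightarrow> y = fun_app d \<xi>" "fun_app d \<xi> \<in> elts A"
    by (simp_all add: iff y0(1))
qed

lemma fun_app_eqI: "function_set D \<beta> A \<Longrightarrow> d \<in> elts D \<Longrightarrow> \<xi> \<in> elts \<beta> \<Longrightarrow> kpair \<xi> y \<in> elts d \<Longrightarrow> fun_app d \<xi> = y"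
  using kpair_mem_iff_fun_app by metis

lemma all_functions_exist: "\<exists>D. all_functions D \<beta> (A :: 'v::set_universe)"
proof -
  \<comment> \<open>\<open>function_set\<close> speaks about a set of functions, so a single
    \<open>d\<close> enters through its singleton.\<close>
  define X where "X = {d. elts d \<subseteq> elts (prod_set \<beta> A) \<and> function_set (set_of {d}) \<beta> A}"
  have "small X" unfolding X_def by (rule small_subset[OF small_Pow[of "prod_set \<beta> A"]]) auto
  then have D: "elts (set_of X) = X" by (rule elts_set_of)
  have fs: "function_set (set_of X) \<beta> A" unfolding function_set_def D
    unfolding X_def function_set_def by simp
  have "\<exists>d\<in>elts (set_of X). \<forall>\<xi>\<in>elts \<beta>. fun_app d \<xi> = f \<xi>"
    if "f ` elts \<beta> \<subseteq> elts A" for f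
  proof -
    have "\<exists>\<xi>\<in>elts \<beta>. \<exists>y\<in>elts A. z = kpair \<xi> y" if "z \<in> elts (graph \<beta> f)" for z
      using that \<open>f ` elts \<beta> \<subseteq> elts A\<close> unfolding elts_graph by blast
    moreover from this have "elts (graph \<beta> f) \<subseteq> elts (prod_set \<beta> A)"
      unfolding elts_prod_set by blast
    ultimately have "graph \<beta> f \<in> elts (set_of X)" unfolding D
      using that by (auto simp: X_def function_set_def)
    then show ?thesis using fun_app_eqI[OF fs] by (metis kpair_in_graph)
  qed
  then show ?thesis using fs unfolding all_functions_def by blast
qed

lemma bounded_function_set: "bounded_pred (\<lambda>s. function_set (s a) (s b) (s c))"
  unfolding function_set_def by (intro bounded)

text \<open>Tuples are nested pairs, rather than functions on a natural number, so that elementary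
  embeddings commute with the coding because they commute with pairing.\<close>

primrec tuple_code :: "'v::set_universe list \<Rightarrow> 'v" where
  "tuple_code [] = set_of {}"
| "tuple_code (x # xs) = kpair x (tuple_code xs)"

primrec tuple_set :: "'v::set_universe \<Rightarrow> nat \<Rightarrow> 'v" where
  "tuple_set A 0 = set_of {set_of {}}"
| "tuple_set A (Suc n) = prod_set A (tuple_set A n)"

lemma tuple_code_inj: "length xs = length ys \<Longrightarrow> tuple_code xs = tuple_code ys \<longleftrightarrow> xs = ys"
  by (induction xs ys rule: list_induct2) auto

lemma elts_tuple_set:
  "elts (tuple_set A n) = tuple_code ` {xs. length xs = n \<and> set xs \<subseteq> elts A}"
proof (induction n)
  case 0
  show ?case by auto
next
  case (Suc n)
  have "{xs. length xs = Suc n \<and> set xs \<subseteq> elts A} =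
      (\<Union>a\<in>elts A. (#) a ` {xs. length xs = n \<and> set xs \<subseteq> elts A})"
    by (auto simp: length_Suc_conv)
  then show ?case by (simp add: elts_prod_set Suc image_UN image_image)
qed

definition tuple_decode :: "nat \<Rightarrow> 'v::set_universe \<Rightarrow> 'v list" where
  "tuple_decode n c = (THE xs. length xs = n \<and> tuple_code xs = c)"

lemma tuple_decode_code [simp]: "length xs = n \<Longrightarrow> tuple_decode n (tuple_code xs) = xs"
  unfolding tuple_decode_def by (rule the_equality) (auto simp: tuple_code_inj)

section \<open>The action of an embedding on functions and predicates\<close>

context embedding
begin

text \<open>A HOL function is not an element of V, so \<open>j\<close> acts on it through its graph
  on \<open>A\<close>; the result is a function on all of \<open>j A\<close>, not only on the images
  \<open>j x\<close>. Predicates are treated in the same way through their extension in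
  \<open>A\<close>.\<close>

definition jfun :: "'v \<Rightarrow> ('v \<Rightarrow> 'v) \<Rightarrow> 'v \<Rightarrow> 'v" where
  "jfun A h x = fun_app (j (graph A h)) x"

definition jpred :: "'v \<Rightarrow> ('v \<Rightarrow> bool) \<Rightarrow> 'v \<Rightarrow> bool" where
  "jpred A P x \<longleftrightarrow> x \<in> elts (j (sep A P))"

lemma jfun_cong: "(\<And>x. x \<in> elts A \<Longrightarrow> h x = g x) \<Longrightarrow> jfun A h = jfun A g"
proof -
  assume "\<And>x. x \<in> elts A \<Longrightarrow> h x = g x"
  then have "graph A h = graph A g" unfolding graph_def by (auto intro!: arg_cong[of _ _ set_of])
  then show ?thesis by (auto simp: jfun_def)
qed

lemma jpred_cong: "(\<And>x. x \<in> elts A \<Longrightarrow> P x = Q x) \<Longrightarrow> jpred A P = jpred A Q"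
proof -
  assume "\<And>x. x \<in> elts A \<Longrightarrow> P x = Q x"
  then have "sep A P = sep A Q" unfolding sep_def by (auto intro!: arg_cong[of _ _ set_of])
  then show ?thesis by (auto simp: jpred_def)
qed

lemma function_set_j_graph:
  "function_set (set_of {j (graph A h)}) (j A) (j (image_set h A))"
proof -
  have "bounded_pred (\<lambda>s. (\<forall>z\<in>elts (s 2). \<exists>\<xi>\<in>elts (s 0). \<exists>y\<in>elts (s 1). z = kpair \<xi> y) \<and>
     (\<forall>\<xi>\<in>elts (s 0). \<exists>y\<in>elts (s 1). kpair \<xi> y \<in> elts (s 2) \<and>
        (\<forall>y'\<in>elts (s 1). kpair \<xi> y' \<in> elts (s 2) \<longrightarrow> y' = y)))"
    by (intro bounded)
  from transfer3[of "\<lambda>\<beta> A d. (\<forall>z\<in>elts d. \<exists>\<xi>\<in>elts \<beta>. \<exists>y\<in>elts A. z = kpair \<xi> y) \<and>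
     (\<forall>\<xi>\<in>elts \<beta>. \<exists>y\<in>elts A. kpair \<xi> y \<in> elts d \<and> (\<forall>y'\<in>elts A. kpair \<xi> y' \<in> elts d \<longrightarrow> y' = y))"
     A "image_set h A" "graph A h", OF this]
  show ?thesis unfolding function_set_def by (simp add: elts_graph image_iff) blast
qed

lemma jfun_graph: "x \<in> elts (j A) \<Longrightarrow> kpair x y \<in> elts (j (graph A h)) \<longleftrightarrow> y = jfun A h x"
  unfolding jfun_def by (rule kpair_mem_iff_fun_app[OF function_set_j_graph]) auto

lemma jfun_mem: "x \<in> elts (j A) \<Longrightarrow> kpair x (jfun A h x) \<in> elts (j (graph A h))"
  by (simp add: jfun_graph)

lemma jfun_in_image: "x \<in> elts (j A) \<Longrightarrow> jfun A h x \<in> elts (j (image_set h A))"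
  unfolding jfun_def by (rule fun_app_in[OF function_set_j_graph]) auto

lemma jfun_in:
  assumes "\<And>x. x \<in> elts A \<Longrightarrow> h x \<in> elts B" "x \<in> elts (j A)" shows "jfun A h x \<in> elts (j B)"
proof -
  have "elts (image_set h A) \<subseteq> elts B" using assms(1) by auto
  then show ?thesis using jfun_in_image[OF assms(2)] j_subset_iff by blast
qed

lemma jfun_j: "x \<in> elts A \<Longrightarrow> jfun A h (j x) = j (h x)"
  by (metis j_mem_iff j_kpair jfun_graph kpair_in_graph)

lemma jpred_j: "jpred A P (j x) \<longleftrightarrow> x \<in> elts A \<and> P x"
  by (simp add: jpred_def)

lemma jfun_id: "x \<in> elts (j A) \<Longrightarrow> jfun A (\<lambda>x. x) x = x"
proof -
  assume x: "x \<in> elts (j A)"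
  have "bounded_pred (\<lambda>s. \<forall>x\<in>elts (s 0). kpair x x \<in> elts (s 1))" by (intro bounded)
  from transfer2[of "\<lambda>A G. \<forall>x\<in>elts A. kpair x x \<in> elts G" A "graph A (\<lambda>x. x)", OF this]
  have "kpair x x \<in> elts (j (graph A (\<lambda>x. x)))" using x by simp
  then show ?thesis using jfun_graph x by metis
qed

lemma j_singleton: "j (set_of {c}) = set_of {j c}"
  using transfer3[of "\<lambda>z x y. z = set_of {x, y}" "set_of {c}" c c] by (simp add: bounded)

lemma jfun_const: "x \<in> elts (j A) \<Longrightarrow> jfun A (\<lambda>_. c) x = j c"
  using jfun_in[of A "\<lambda>_. c" "set_of {c}" x] by (simp add: j_singleton)

text \<open>The law relating the three graphs is a bounded statement about V. After transfer it
  speaks about every \<open>x\<close> in \<open>j A\<close>, whether or not \<open>x\<close> is in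
  the range of \<open>j\<close>. The laws for pairs, predicates and equality use the same
  method.\<close>

lemma jfun_comp:
  assumes h: "\<And>x. x \<in> elts A \<Longrightarrow> h x \<in> elts B" and x: "x \<in> elts (j A)"
  shows "jfun A (\<lambda>x. g (h x)) x = jfun B g (jfun A h x)"
proof -
  let ?P = "\<lambda>A B C G H K _. \<forall>x\<in>elts A. \<forall>y\<in>elts B. \<forall>z\<in>elts C.
      kpair x y \<in> elts G \<and> kpair y z \<in> elts H \<longrightarrow> kpair x z \<in> elts K"
  have bnd: "bounded_pred (\<lambda>s. ?P (s 0) (s 1) (s 2) (s 3) (s 4) (s 5) (s 6))" by (intro bounded)
  have "?P (j A) (j B) (j (image_set g B)) (j (graph A h)) (j (graph B g)) (j (graph A (\<lambda>x. g (h x)))) (j A)"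
    by (rule iffD1[OF transfer7[of ?P A B "image_set g B" "graph A h" "graph B g" "graph A (\<lambda>x. g (h x))" A, OF bnd]]) simp
  moreover have "jfun A h x \<in> elts (j B)" by (rule jfun_in[OF h x])
  ultimately have "kpair x (jfun B g (jfun A h x)) \<in> elts (j (graph A (\<lambda>x. g (h x))))"
    using x jfun_mem jfun_in_image by blast
  then show ?thesis using jfun_graph[OF x] by simp
qed

lemma jfun_pair:
  assumes x: "x \<in> elts (j A)"
  shows "jfun A (\<lambda>x. kpair (h x) (g x)) x = kpair (jfun A h x) (jfun A g x)"
proof -
  \<comment> \<open>The pair of the two values is a variable \<open>p\<close> bounded by
    \<open>E\<close>, because the rules for \<open>kpair\<close> admit only variables as
    components.\<close>
  let ?P = "\<lambda>A B C E G H K. \<forall>x\<in>elts A. \<forall>y\<in>elts B. \<forall>z\<in>elts C.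
      kpair x y \<in> elts G \<and> kpair x z \<in> elts H \<longrightarrow> (\<exists>p\<in>elts E. p = kpair y z \<and> kpair x p \<in> elts K)"
  let ?k = "\<lambda>x. kpair (h x) (g x)"
  have bnd: "bounded_pred (\<lambda>s. ?P (s 0) (s 1) (s 2) (s 3) (s 4) (s 5) (s 6))" by (intro bounded)
  have "?P (j A) (j (image_set h A)) (j (image_set g A)) (j (image_set ?k A))
      (j (graph A h)) (j (graph A g)) (j (graph A ?k))"
    by (rule iffD1[OF transfer7[of ?P A "image_set h A" "image_set g A" "image_set ?k A"
      "graph A h" "graph A g" "graph A ?k", OF bnd]]) simp
  then have "\<exists>p\<in>elts (j (image_set ?k A)). p = kpair (jfun A h x) (jfun A g x) \<and>
      kpair x p \<in> elts (j (graph A ?k))"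
    using x jfun_mem[OF x, of h] jfun_mem[OF x, of g]
      jfun_in_image[OF x, of h] jfun_in_image[OF x, of g] by blast
  then show ?thesis using jfun_graph[OF x] by auto
qed

lemma jpred_comp:
  assumes h: "\<And>x. x \<in> elts A \<Longrightarrow> h x \<in> elts B" and x: "x \<in> elts (j A)"
  shows "jpred A (\<lambda>x. P (h x)) x \<longleftrightarrow> jpred B P (jfun A h x)"
proof -
  let ?P = "\<lambda>A B G S T _ _. \<forall>x\<in>elts A. \<forall>y\<in>elts B.
      kpair x y \<in> elts G \<longrightarrow> (x \<in> elts S \<longleftrightarrow> y \<in> elts T)"
  have bnd: "bounded_pred (\<lambda>s. ?P (s 0) (s 1) (s 2) (s 3) (s 4) (s 5) (s 6))" by (intro bounded)
  have "?P (j A) (j B) (j (graph A h)) (j (sep A (\<lambda>x. P (h x)))) (j (sep B P)) A A"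
    by (rule iffD1[OF transfer7[of ?P A B "graph A h" "sep A (\<lambda>x. P (h x))" "sep B P" A A, OF bnd]]) simp
  moreover have "jfun A h x \<in> elts (j B)" by (rule jfun_in[OF h x])
  ultimately show ?thesis using x jfun_mem unfolding jpred_def by blast
qed

lemma jpred_eq:
  assumes x: "x \<in> elts (j A)"
  shows "jpred A (\<lambda>x. h x = g x) x \<longleftrightarrow> jfun A h x = jfun A g x"
proof -
  let ?P = "\<lambda>A B C G H S _. \<forall>x\<in>elts A. \<forall>y\<in>elts B. \<forall>z\<in>elts C.
      kpair x y \<in> elts G \<and> kpair x z \<in> elts H \<longrightarrow> (x \<in> elts S \<longleftrightarrow> y = z)"
  have bnd: "bounded_pred (\<lambda>s. ?P (s 0) (s 1) (s 2) (s 3) (s 4) (s 5) (s 6))" by (intro bounded)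
  have "?P (j A) (j (image_set h A)) (j (image_set g A)) (j (graph A h)) (j (graph A g))
      (j (sep A (\<lambda>x. h x = g x))) A"
    by (rule iffD1[OF transfer7[of ?P A "image_set h A" "image_set g A" "graph A h" "graph A g"
      "sep A (\<lambda>x. h x = g x)" A, OF bnd]]) simp
  then show ?thesis using x jfun_mem jfun_in_image unfolding jpred_def by blast
qed

lemma jpred_not:
  assumes x: "x \<in> elts (j A)"
  shows "jpred A (\<lambda>x. \<not> P x) x \<longleftrightarrow> \<not> jpred A P x"
proof -
  let ?P = "\<lambda>A S T. \<forall>x\<in>elts A. x \<in> elts S \<longleftrightarrow> \<not> x \<in> elts T"
  have "bounded_pred (\<lambda>s. ?P (s 0) (s 1) (s 2))" by (intro bounded)
  from transfer3[of ?P A "sep A (\<lambda>x. \<not> P x)" "sep A P", OF this]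
  show ?thesis using x unfolding jpred_def by simp
qed

text \<open>As \<open>j\<close> fixes \<open>X\<close> and each of its members, the transferred
  quantifier ranges over the same indices; without this, \<open>j X\<close> could contain new
  ones.\<close>

lemma jpred_all:
  assumes X: "j X = X" "\<And>i. i \<in> elts X \<Longrightarrow> j i = i" and x: "x \<in> elts (j A)"
  shows "jpred A (\<lambda>x. \<forall>i\<in>elts X. P i x) x \<longleftrightarrow> (\<forall>i\<in>elts X. jpred A (P i) x)"
proof -
  \<comment> \<open>A single set codes the whole family \<open>P\<close>, so that the index can be
    quantified inside a formula.\<close>
  define W where "W = sep (prod_set X A) (\<lambda>w. \<exists>i a. w = kpair i a \<and> P i a)"
  have W: "kpair i a \<in> elts W \<longleftrightarrow> i \<in> elts X \<and> a \<in> elts A \<and> P i a" for i a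
    by (auto simp: W_def elts_prod_set)
  let ?P = "\<lambda>A X W S. \<forall>x\<in>elts A. x \<in> elts S \<longleftrightarrow> (\<forall>i\<in>elts X. kpair i x \<in> elts W)"
  have "bounded_pred (\<lambda>s. ?P (s 0) (s 1) (s 2) (s 3))" by (intro bounded)
  from transfer4[of ?P A X W "sep A (\<lambda>x. \<forall>i\<in>elts X. P i x)", OF this]
  have 1: "?P (j A) X (j W) (j (sep A (\<lambda>x. \<forall>i\<in>elts X. P i x)))"
    by (auto simp: W X)
  \<comment> \<open>The section of \<open>j W\<close> at \<open>i\<close> is the image of the
    section of \<open>W\<close> at \<open>i\<close>, since \<open>j i = i\<close>.\<close>
  let ?Q = "\<lambda>A i W S. \<forall>x\<in>elts A. x \<in> elts S \<longleftrightarrow> kpair i x \<in> elts W"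
  have Q: "bounded_pred (\<lambda>s. ?Q (s 0) (s 1) (s 2) (s 3))" by (intro bounded)
  have "?Q (j A) i (j W) (j (sep A (P i)))" if "i \<in> elts X" for i
    using transfer4[of ?Q A i W "sep A (P i)", OF Q] that by (auto simp: W X)
  with 1 show ?thesis using x unfolding jpred_def by blast
qed

text \<open>A member \<open>i\<close> of \<open>j X\<close> lies in \<beta>, hence equals
  \<open>j i\<close>, and then elementarity puts it into \<open>X\<close>.\<close>

lemma j_fixed_subset:
  assumes "j \<beta> = \<beta>" "\<And>i. i \<in> elts \<beta> \<Longrightarrow> j i = i" "elts X \<subseteq> elts \<beta>" shows "j X = X"
proof (rule extensionality)
  have "elts (j X) \<subseteq> elts (j \<beta>)" using assms(3) j_subset_iff by blast
  then have "i \<in> elts (j X) \<longleftrightarrow> i \<in> elts X" for i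
    using assms j_mem_iff[of i X] by (metis subsetD)
  then show "elts (j X) = elts X" by blast
qed

lemma j_empty: "j (set_of {}) = set_of {}"
proof -
  have "bounded_pred (\<lambda>s. (\<forall>x\<in>elts (s 0). x \<noteq> x) \<and> s 1 = s 1)" by (intro bounded)
  from transfer2[of "\<lambda>z y. (\<forall>x\<in>elts z. x \<noteq> x) \<and> y = y" "set_of {}" "set_of {}", OF this]
  have "elts (j (set_of {})) = {}" by auto
  then show ?thesis by (intro extensionality) simp
qed

lemma j_prod_set: "j (prod_set x y) = prod_set (j x) (j y)"
proof (rule extensionality)
  let ?P = "\<lambda>x y z. (\<forall>w\<in>elts z. \<exists>a\<in>elts x. \<exists>b\<in>elts y. w = kpair a b) \<and>
      (\<forall>a\<in>elts x. \<forall>b\<in>elts y. kpair a b \<in> elts z)"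
  have "bounded_pred (\<lambda>s. ?P (s 0) (s 1) (s 2))" by (intro bounded)
  from transfer3[of ?P x y "prod_set x y", OF this]
  have "?P (j x) (j y) (j (prod_set x y))" by (auto simp: elts_prod_set)
  then show "elts (j (prod_set x y)) = elts (prod_set (j x) (j y))" unfolding elts_prod_set by blast
qed

lemma j_tuple_set: "j (tuple_set A n) = tuple_set (j A) n"
  by (induction n) (simp_all add: j_prod_set j_singleton j_empty)

lemma j_tuple_code: "j (tuple_code xs) = tuple_code (map j xs)"
  by (induction xs) (simp_all add: j_kpair j_empty)

lemma jfun_tuple_code:
  "x \<in> elts (j A) \<Longrightarrow>
    jfun A (\<lambda>x. tuple_code (map (\<lambda>t. h t x) ts)) x = tuple_code (map (\<lambda>t. jfun A (h t) x) ts)"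
  by (induction ts) (simp_all add: jfun_const j_empty jfun_pair)

text \<open>The images of \<open>h\<close> and of its inverse are inverse to each other by
  \<open>jfun_comp\<close> and \<open>jfun_id\<close>. This later compares the size of the image of
  a structure with that of the image of its cardinal.\<close>

lemma jfun_bij_betw:
  assumes "bij_betw h (elts A) (elts B)" shows "bij_betw (jfun A h) (elts (j A)) (elts (j B))"
proof -
  let ?g = "inv_into (elts A) h"
  have h: "h x \<in> elts B" "?g (h x) = x" if "x \<in> elts A" for x
    using assms that by (auto simp: bij_betw_def)
  have g: "?g y \<in> elts A" "h (?g y) = y" if "y \<in> elts B" for y
    using assms that by (auto simp: bij_betw_def inv_into_into f_inv_into_f)
  have 1: "jfun B ?g (jfun A h x) = x" if "x \<in> elts (j A)" for x
    using jfun_comp[of A h B x ?g] jfun_id[OF that] jfun_cong[of A "\<lambda>x. ?g (h x)" "\<lambda>x. x"] h that by simp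
  have 2: "jfun A h (jfun B ?g y) = y" if "y \<in> elts (j B)" for y
    using jfun_comp[of B ?g A y h] jfun_id[OF that] jfun_cong[of B "\<lambda>y. h (?g y)" "\<lambda>x. x"] g that by simp
  show ?thesis
    by (rule bij_betw_byWitness[where f'="jfun B ?g"]) (use 1 2 jfun_in h(1) g(1) in blast)+
qed

end

section \<open>Formulas\<close>

text \<open>Bound variables are included because one coding of variables by ordinals has to serve
  all subformulas of an induction.\<close>

primrec fm_vars :: "'v::set_universe fm \<Rightarrow> 'v set" where
  "fm_vars (Eq t u) = fv_tm t \<union> fv_tm u"
| "fm_vars (Rel R ts) = (\<Union>t\<in>set ts. fv_tm t)"
| "fm_vars (Neg p) = fm_vars p"
| "fm_vars (Conj I F) = (\<Union>i\<in>elts I. fm_vars (F i))"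
| "fm_vars (Ex X p) = elts X \<union> fm_vars p"

lemma fv_subset_fm_vars: "fv p \<subseteq> fm_vars p"
  by (induction p) auto

lemma val_cong: "(\<And>x. x \<in> fv_tm t \<Longrightarrow> s x = s' x) \<Longrightarrow> val M s t = val M s' t"
proof (induction t)
  case (App f ts)
  have "map (val M s) ts = map (val M s') ts"
    using App by (intro map_cong refl App.IH) auto
  then show ?case by (simp only: val.simps)
qed simp

lemma sat_cong: "(\<And>x. x \<in> fv p \<Longrightarrow> s x = s' x) \<Longrightarrow> sat M p s = sat M p s'"
proof (induction p arbitrary: s s')
  case (Eq t u)
  then have "val M s t = val M s' t" "val M s u = val M s' u" by (auto intro!: val_cong)
  then show ?case by simp
next
  case (Rel R ts)
  then have "map (val M s) ts = map (val M s') ts" by (auto intro!: val_cong)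
  then show ?case by (simp only: sat.simps)
next
  case (Neg p)
  have "sat M p s = sat M p s'" using Neg.prems by (intro Neg.IH) simp
  then show ?case by simp
next
  case (Conj I F)
  have "sat M (F i) s = sat M (F i) s'" if "i \<in> elts I" for i
    by (rule Conj.IH) (use that Conj.prems in auto)
  then show ?case by simp
next
  case (Ex X p)
  have *: "sat M (fm.Ex X p) s'"
    if eq: "\<And>x. x \<in> fv (fm.Ex X p) \<Longrightarrow> s x = s' x" and sat: "sat M (fm.Ex X p) s" for s s'
  proof -
    obtain t where t: "\<And>x. x \<in> elts X \<Longrightarrow> t x \<in> elts (dom_of M)"
      "\<And>x. x \<notin> elts X \<Longrightarrow> t x = s x" "sat M p t"
      using sat by auto
    let ?t = "\<lambda>x. if x \<in> elts X then t x else s' x"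
    have "sat M p t = sat M p ?t" using t(2) eq by (intro Ex.IH) auto
    then have "sat M p ?t" using t(3) by (rule iffD1)
    moreover have "\<forall>x\<in>elts X. ?t x \<in> elts (dom_of M)" using t(1) by simp
    moreover have "\<forall>x. x \<notin> elts X \<longrightarrow> ?t x = s' x" by simp
    ultimately show ?thesis unfolding sat.simps by (intro exI[of _ ?t] conjI)
  qed
  show ?case
  proof
    assume "sat M (fm.Ex X p) s"
    then show "sat M (fm.Ex X p) s'" by (rule *[of s s', rotated]) (rule Ex.prems)
  next
    assume "sat M (fm.Ex X p) s'"
    then show "sat M (fm.Ex X p) s" by (rule *[of s' s, rotated]) (rule Ex.prems[symmetric])
  qed
qed

lemma val_in:
  assumes "is_structure \<tau> M" "wf_tm \<tau> t" "\<And>x. s x \<in> elts (dom_of M)"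
  shows "val M s t \<in> elts (dom_of M)"
  using assms(2)
proof (induction t)
  case (App f ts)
  then have "map (val M s) ts \<in> tuples M (fun_arity \<tau> f)"
    by (auto simp: tuples_def list_all_iff)
  then show ?case using assms(1) App.prems by (auto simp: is_structure_def)
qed (use assms(3) in simp)

section \<open>Regular cardinals\<close>

text \<open>By regularity the range of an injection into \<eta> is bounded. Index sets and variables
  can thus be replaced by ordinals below some \<beta> < \<eta>, which the embedding fixes.\<close>

lemma regular_bounded_injection:
  assumes "regular_Card \<eta>" "X \<prec> elts \<eta>"
  shows "\<exists>\<beta>\<in>elts \<eta>. \<exists>g. inj_on g X \<and> g ` X \<subseteq> elts \<beta>"
proof -
  obtain g where g: "inj_on g X" "g ` X \<subseteq> elts \<eta>"
    using assms(2) unfolding lesspoll_def lepoll_def by blast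
  have "g ` X \<prec> elts \<eta>" using assms(2) image_lepoll lesspoll_trans1 by blast
  then obtain \<beta> where "\<beta> \<in> elts \<eta>" "g ` X \<subseteq> elts \<beta>"
    using assms(1) g(2) unfolding regular_Card_def by blast
  then show ?thesis using g by blast
qed

text \<open>Each \<open>B i\<close> injects into some ordinal below \<eta>; regularity gives a
  common bound \<gamma> < \<eta>, and the union injects into
  \<open>I \<times> elts \<gamma>\<close>.\<close>

lemma regular_UN_lesspoll:
  assumes \<eta>: "regular_Card \<eta>" and I: "I \<prec> elts \<eta>" and B: "\<And>i. i \<in> I \<Longrightarrow> B i \<prec> elts \<eta>"
  shows "(\<Union>i\<in>I. B i) \<prec> elts \<eta>"
proof -
  have card: "is_Card \<eta>" and inf: "infinite (elts \<eta>)" using \<eta> by (auto simp: regular_Card_def)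
  have "\<forall>i\<in>I. \<exists>\<beta> g. \<beta> \<in> elts \<eta> \<and> inj_on g (B i) \<and> g ` B i \<subseteq> elts \<beta>"
    using regular_bounded_injection[OF \<eta> B] by blast
  then obtain \<beta> g where g: "\<And>i. i \<in> I \<Longrightarrow> \<beta> i \<in> elts \<eta>" "\<And>i. i \<in> I \<Longrightarrow> inj_on (g i) (B i)"
    "\<And>i. i \<in> I \<Longrightarrow> g i ` B i \<subseteq> elts (\<beta> i)"
    by metis
  have "\<beta> ` I \<prec> elts \<eta>" using I image_lepoll lesspoll_trans1 by blast
  moreover have "\<beta> ` I \<subseteq> elts \<eta>" using g(1) by blast
  ultimately obtain \<gamma> where \<gamma>: "\<gamma> \<in> elts \<eta>" "\<beta> ` I \<subseteq> elts \<gamma>"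
    using \<eta> unfolding regular_Card_def by blast
  have "is_Ord \<gamma>" using \<gamma>(1) card is_Card_Ord is_Ord_mem by blast
  then have sub: "elts (\<beta> i) \<subseteq> elts \<gamma>" if "i \<in> I" for i
    using \<gamma>(2) that is_Ord_trans by blast
  \<comment> \<open>The sets \<open>B i\<close> may overlap, so one index is chosen for each
    element.\<close>
  define ix where "ix x = (SOME i. i \<in> I \<and> x \<in> B i)" for x
  have ix: "ix x \<in> I \<and> x \<in> B (ix x)" if "x \<in> (\<Union>i\<in>I. B i)" for x
    unfolding ix_def by (rule someI_ex) (use that in blast)
  have "inj_on (\<lambda>x. (ix x, g (ix x) x)) (\<Union>i\<in>I. B i)"
    by (rule inj_onI) (metis Pair_inject g(2) inj_onD ix)
  moreover have "(\<lambda>x. (ix x, g (ix x) x)) ` (\<Union>i\<in>I. B i) \<subseteq> I \<times> elts \<gamma>"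
    using ix g(3) sub by blast
  ultimately have "(\<Union>i\<in>I. B i) \<lesssim> I \<times> elts \<gamma>" unfolding lepoll_def by blast
  also have "I \<times> elts \<gamma> \<prec> elts \<eta>"
    by (rule lesspoll_Times_infinite[OF inf I Card_mem_lesspoll[OF card \<gamma>(1)]])
  finally show ?thesis .
qed

lemma finite_fv_tm: "finite (fv_tm t)"
  by (induction t) auto

lemma fm_vars_lesspoll:
  assumes \<eta>: "regular_Card \<eta>" shows "in_logic \<eta> \<tau> p \<Longrightarrow> fm_vars p \<prec> elts \<eta>"
proof (induction p)
  case (Ex X p)
  then have X: "elts X \<prec> elts \<eta>" "fm_vars p \<prec> elts \<eta>" by auto
  \<comment> \<open>The union of two sets is written as a union indexed by the booleans.\<close>
  have "(\<Union>b\<in>UNIV. if b then elts X else fm_vars p) \<prec> elts \<eta>"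
    using X \<eta> by (intro regular_UN_lesspoll[OF \<eta>])
      (auto intro!: finite_lesspoll_infinite simp: regular_Card_def)
  then show ?case by (simp add: UNIV_bool Un_commute)
next
  case (Conj I F)
  then show ?case by (auto intro!: regular_UN_lesspoll[OF \<eta>])
next
  case (Neg p)
  then show ?case by simp
qed (use \<eta> in \<open>simp_all add: finite_lesspoll_infinite regular_Card_def finite_fv_tm\<close>)

section \<open>The image of a structure under an elementary embedding\<close>

lemma all_functions_function_set: "all_functions D \<beta> A \<Longrightarrow> function_set D \<beta> A"
  by (simp add: all_functions_def)

lemma sat_Ex_coded:
  assumes D: "all_functions D \<beta> (dom_of M)" and e: "\<And>x. e x \<in> elts \<beta>" "inj_on e Y"
    and vars: "elts X \<subseteq> Y" "fv p \<subseteq> Y" and d: "d \<in> elts D"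
  shows "sat M (Ex X p) (\<lambda>x. fun_app d (e x)) \<longleftrightarrow>
    (\<exists>d'\<in>elts D. (\<forall>\<xi>\<in>elts \<beta>. \<xi> \<in> e ` elts X \<or> fun_app d' \<xi> = fun_app d \<xi>) \<and>
       sat M p (\<lambda>x. fun_app d' (e x)))"
    (is "?L = ?R")
proof
  note in_dom = fun_app_in[OF all_functions_function_set[OF D]]
  assume ?L
  then obtain s where s: "\<And>x. x \<in> elts X \<Longrightarrow> s x \<in> elts (dom_of M)"
    "\<And>x. x \<notin> elts X \<Longrightarrow> s x = fun_app d (e x)" "sat M p s"
    by auto
  \<comment> \<open>The code of \<open>s\<close>: positions of quantified variables take the new
    values, all others keep those of \<open>d\<close>.\<close>
  define f where "f \<xi> = (if \<xi> \<in> e ` elts X then s (inv_into Y e \<xi>) else fun_app d \<xi>)" for \<xi>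
  have fe: "f (e x) = s x" if x: "x \<in> Y" for x
  proof (cases "x \<in> elts X")
    case True
    then show ?thesis using x e(2) by (simp add: f_def)
  next
    case False
    then have "e x \<notin> e ` elts X" using x e(2) vars(1) unfolding inj_on_def by blast
    then show ?thesis using s(2)[OF False] by (simp add: f_def)
  qed
  have "f \<xi> \<in> elts (dom_of M)" if "\<xi> \<in> elts \<beta>" for \<xi>
  proof (cases "\<xi> \<in> e ` elts X")
    case True
    then obtain x where "x \<in> elts X" "\<xi> = e x" by blast
    then show ?thesis using s(1) fe vars(1) by (simp add: subset_iff)
  next
    case False
    then show ?thesis using in_dom[OF d that] by (simp add: f_def)
  qed
  then have "f ` elts \<beta> \<subseteq> elts (dom_of M)" by blast
  then obtain d' where d': "d' \<in> elts D" "\<And>\<xi>. \<xi> \<in> elts \<beta> \<Longrightarrow> fun_app d' \<xi> = f \<xi>"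
    using D unfolding all_functions_def by blast
  have "sat M p s = sat M p (\<lambda>x. fun_app d' (e x))"
    using vars(2) fe d'(2) e(1) by (intro sat_cong) auto
  then have "sat M p (\<lambda>x. fun_app d' (e x))" using s(3) by (rule iffD1)
  moreover have "\<forall>\<xi>\<in>elts \<beta>. \<xi> \<in> e ` elts X \<or> fun_app d' \<xi> = fun_app d \<xi>"
    using d'(2) by (simp add: f_def)
  ultimately show ?R using d'(1) by blast
next
  note in_dom = fun_app_in[OF all_functions_function_set[OF D]]
  assume ?R
  then obtain d' where d': "d' \<in> elts D" "sat M p (\<lambda>x. fun_app d' (e x))"
    "\<And>\<xi>. \<xi> \<in> elts \<beta> \<Longrightarrow> \<xi> \<notin> e ` elts X \<Longrightarrow> fun_app d' \<xi> = fun_app d \<xi>"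
    by blast
  let ?s = "\<lambda>x. if x \<in> elts X then fun_app d' (e x) else fun_app d (e x)"
  have "e x \<notin> e ` elts X" if "x \<in> Y" "x \<notin> elts X" for x
    using that e(2) vars(1) by (auto simp: inj_on_def)
  then have "sat M p (\<lambda>x. fun_app d' (e x)) = sat M p ?s"
    using vars(2) d'(3)[OF e(1)] by (intro sat_cong) auto
  then have "sat M p ?s" using d'(2) by (rule iffD1)
  moreover have "\<forall>x\<in>elts X. ?s x \<in> elts (dom_of M)" using in_dom[OF d'(1) e(1)] by simp
  moreover have "\<forall>x. x \<notin> elts X \<longrightarrow> ?s x = fun_app d (e x)" by simp
  ultimately show ?L unfolding sat.simps by (intro exI[of _ ?s] conjI)
qed

section \<open>The image structure and transfer of satisfaction\<close>

context embedding
begin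

text \<open>This is \<open>j(M)\<close> with each symbol keeping its name, so the vocabulary does
  not move. Interpretations act on lists; they are moved as functions and predicates of tuple codes,
  and the length of the argument list selects the tuple set.\<close>

definition jstruct :: "'v struct \<Rightarrow> 'v struct" where
  "jstruct M = \<lparr>dom_of = j (dom_of M),
     rel_int = \<lambda>R ys. jpred (tuple_set (dom_of M) (length ys))
       (\<lambda>c. rel_int M R (tuple_decode (length ys) c)) (tuple_code ys),
     fun_int = \<lambda>f ys. jfun (tuple_set (dom_of M) (length ys))
       (\<lambda>c. fun_int M f (tuple_decode (length ys) c)) (tuple_code ys)\<rparr>"

lemma dom_jstruct [simp]: "dom_of (jstruct M) = j (dom_of M)"
  by (simp add: jstruct_def)

lemma tuple_decode_in_tuples:
  "c \<in> elts (tuple_set (dom_of M) n) \<Longrightarrow> tuple_decode n c \<in> tuples M n"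
  by (auto simp: elts_tuple_set tuples_def)

lemma tuple_code_in_tuple_set:
  "xs \<in> tuples M n \<Longrightarrow> tuple_code xs \<in> elts (tuple_set (dom_of M) n)"
  by (auto simp: elts_tuple_set tuples_def)

lemma is_structure_jstruct:
  assumes "is_structure \<tau> M" shows "is_structure \<tau> (jstruct M)"
proof -
  have "fun_int (jstruct M) f ys \<in> elts (j (dom_of M))"
    if "f \<in> elts (fun_syms \<tau>)" "ys \<in> tuples (jstruct M) (fun_arity \<tau> f)" for f ys
  proof -
    have len: "length ys = fun_arity \<tau> f" using that by (simp add: tuples_def)
    have "tuple_code ys \<in> elts (j (tuple_set (dom_of M) (fun_arity \<tau> f)))"
      using tuple_code_in_tuple_set[OF that(2)] by (simp add: j_tuple_set)
    moreover have "fun_int M f (tuple_decode (fun_arity \<tau> f) c) \<in> elts (dom_of M)"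
      if "c \<in> elts (tuple_set (dom_of M) (fun_arity \<tau> f))" for c
      using assms \<open>f \<in> elts (fun_syms \<tau>)\<close> tuple_decode_in_tuples[OF that]
      by (simp add: is_structure_def)
    ultimately have "jfun (tuple_set (dom_of M) (fun_arity \<tau> f))
        (\<lambda>c. fun_int M f (tuple_decode (fun_arity \<tau> f) c)) (tuple_code ys) \<in> elts (j (dom_of M))"
      by (intro jfun_in)
    then show ?thesis by (simp add: jstruct_def len)
  qed
  moreover have "elts (j (dom_of M)) \<noteq> {}"
    using assms j_mem_iff unfolding is_structure_def by blast
  ultimately show ?thesis by (simp add: is_structure_def)
qed

lemma fun_int_jstruct_j:
  "xs \<in> tuples M n \<Longrightarrow> fun_int (jstruct M) f (map j xs) = j (fun_int M f xs)"
  using tuple_code_in_tuple_set[of xs M n]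
  by (simp add: jstruct_def j_tuple_code[symmetric] jfun_j tuples_def)

lemma rel_int_jstruct_j:
  "xs \<in> tuples M n \<Longrightarrow> rel_int (jstruct M) R (map j xs) = rel_int M R xs"
  using tuple_code_in_tuple_set[of xs M n]
  by (simp add: jstruct_def j_tuple_code[symmetric] jpred_j tuples_def)

lemma function_set_j: "function_set D \<beta> A \<Longrightarrow> function_set (j D) (j \<beta>) (j A)"
  using transfer3[of function_set D \<beta> A, OF bounded_function_set] by simp

lemma jfun_fun_app:
  assumes D: "function_set D \<beta> A" and \<xi>: "\<xi> \<in> elts \<beta>" and x: "x \<in> elts (j D)"
  shows "jfun D (\<lambda>d. fun_app d \<xi>) x = fun_app x (j \<xi>)"
proof -
  let ?P = "\<lambda>D A \<xi> G. \<forall>d\<in>elts D. \<forall>y\<in>elts A. kpair \<xi> y \<in> elts d \<longrightarrow> kpair d y \<in> elts G"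
  have bnd: "bounded_pred (\<lambda>s. ?P (s 0) (s 1) (s 2) (s 3))" by (intro bounded)
  have "?P (j D) (j A) (j \<xi>) (j (graph D (\<lambda>d. fun_app d \<xi>)))"
    by (rule iffD1[OF transfer4[of ?P D A \<xi> "graph D (\<lambda>d. fun_app d \<xi>)", OF bnd]])
      (simp add: kpair_mem_iff_fun_app[OF D _ \<xi>])
  moreover have \<xi>': "j \<xi> \<in> elts (j \<beta>)" using \<xi> by simp
  note D' = function_set_j[OF D]
  have "fun_app x (j \<xi>) \<in> elts (j A)" "kpair (j \<xi>) (fun_app x (j \<xi>)) \<in> elts x"
    using fun_app_in[OF D' x \<xi>'] kpair_mem_iff_fun_app[OF D' x \<xi>'] by blast+
  ultimately have "kpair x (fun_app x (j \<xi>)) \<in> elts (j (graph D (\<lambda>d. fun_app d \<xi>)))"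
    using x by blast
  then show ?thesis using jfun_graph[OF x] by simp
qed

text \<open>Replaces the definite description in \<open>fun_app\<close> by a bounded
  statement.\<close>

lemma fun_app_eq_iff:
  assumes "function_set D \<beta> A" "d \<in> elts D" "d' \<in> elts D" "\<xi> \<in> elts \<beta>"
  shows "fun_app d' \<xi> = fun_app d \<xi> \<longleftrightarrow> (\<forall>y\<in>elts A. kpair \<xi> y \<in> elts d' \<longleftrightarrow> kpair \<xi> y \<in> elts d)"
  using kpair_mem_iff_fun_app[OF assms(1,2,4)] kpair_mem_iff_fun_app[OF assms(1,3,4)]
    fun_app_in[OF assms(1,2,4)] fun_app_in[OF assms(1,3,4)] by auto

text \<open>The quantifier over \<open>D\<close> is bounded and therefore transfers. On the right it
  ranges over the members of \<open>j D\<close>; that these are all functions is a separate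
  matter.\<close>

lemma jpred_ex:
  assumes D: "function_set D \<beta> A" and x: "x \<in> elts (j D)"
  shows "jpred D (\<lambda>d. \<exists>d'\<in>elts D. (\<forall>\<xi>\<in>elts \<beta>. \<xi> \<in> elts X \<or> fun_app d' \<xi> = fun_app d \<xi>) \<and> Q d') x \<longleftrightarrow>
    (\<exists>x'\<in>elts (j D). (\<forall>\<xi>\<in>elts (j \<beta>). \<xi> \<in> elts (j X) \<or> fun_app x' \<xi> = fun_app x \<xi>) \<and> jpred D Q x')"
proof -
  let ?S = "sep D (\<lambda>d. \<exists>d'\<in>elts D. (\<forall>\<xi>\<in>elts \<beta>. \<xi> \<in> elts X \<or> fun_app d' \<xi> = fun_app d \<xi>) \<and> Q d')"
  let ?P = "\<lambda>D \<beta> A X S T _. \<forall>d\<in>elts D. d \<in> elts S \<longleftrightarrow> (\<exists>d'\<in>elts D.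
      (\<forall>\<xi>\<in>elts \<beta>. \<xi> \<in> elts X \<or> (\<forall>y\<in>elts A. kpair \<xi> y \<in> elts d' \<longleftrightarrow> kpair \<xi> y \<in> elts d)) \<and> d' \<in> elts T)"
  have bnd: "bounded_pred (\<lambda>s. ?P (s 0) (s 1) (s 2) (s 3) (s 4) (s 5) (s 6))" by (intro bounded)
  have "?P (j D) (j \<beta>) (j A) (j X) (j ?S) (j (sep D Q)) (j D)"
    by (rule iffD1[OF transfer7[of ?P D \<beta> A X ?S "sep D Q" D, OF bnd]])
      (simp add: fun_app_eq_iff[OF D] cong: conj_cong)
  then show ?thesis
    unfolding jpred_def using x by (simp add: fun_app_eq_iff[OF function_set_j[OF D]] cong: conj_cong)
qed

end

text \<open>The closure of \<open>N\<close> is needed only for some element of \<open>N\<close> that contains a given sequence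
  of elements of \<open>N\<close>.  This makes closure under sequences of length \<open>\<eta>\<close> a special case.\<close>

locale closed_embedding = embedding j N for j :: "'v::set_universe \<Rightarrow> 'v" and N +
  fixes \<eta> :: 'v
  assumes regular: "regular_Card \<eta>"
    and fixed: "\<beta> \<in> elts \<eta> \<Longrightarrow> j \<beta> = \<beta>"
    and closed: "\<beta> \<in> elts \<eta> \<Longrightarrow> f ` elts \<beta> \<subseteq> N \<Longrightarrow>
      \<exists>g\<in>N. \<forall>\<xi>\<in>elts \<beta>. \<forall>y. kpair \<xi> y \<in> elts g \<longleftrightarrow> y = f \<xi>"
begin

lemma fixed_mem: "\<beta> \<in> elts \<eta> \<Longrightarrow> \<xi> \<in> elts \<beta> \<Longrightarrow> j \<xi> = \<xi>"
  using regular is_Ord_trans[of \<eta> \<beta> \<xi>] unfolding regular_Card_def is_Card_def by (intro fixed) simp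

text \<open>In V every set \<open>g\<close> that acts as a function from \<beta> to \<open>A\<close>
  is matched on \<beta> by a member of \<open>D\<close>. Hence in \<open>N\<close> every such
  \<open>g\<close> for \<open>j A\<close> is matched by a member of \<open>j D\<close>, and closure
  puts a suitable \<open>g\<close> for the given \<open>f\<close> into \<open>N\<close>.\<close>

lemma all_functions_j:
  assumes D: "all_functions D \<beta> A" and \<beta>: "\<beta> \<in> elts \<eta>" shows "all_functions (j D) \<beta> (j A)"
proof -
  have D0: "function_set D \<beta> A" using D by (rule all_functions_function_set)
  have D': "function_set (j D) \<beta> (j A)" using function_set_j[OF D0] fixed[OF \<beta>] by simp
  have "\<exists>d\<in>elts (j D). \<forall>\<xi>\<in>elts \<beta>. fun_app d \<xi> = f \<xi>" if f: "f ` elts \<beta> \<subseteq> elts (j A)" for f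
  proof -
    have "f ` elts \<beta> \<subseteq> N" using f elts_j_in_N by blast
    from closed[OF \<beta> this]
    obtain g where g: "g \<in> N" "\<And>\<xi> y. \<xi> \<in> elts \<beta> \<Longrightarrow> kpair \<xi> y \<in> elts g \<longleftrightarrow> y = f \<xi>"
      by meson
    \<comment> \<open>\<open>g\<close> need not be in the range of \<open>j\<close>, so it is the
      universally quantified variable of \<open>bounded_transfer_all\<close>; it may also contain
      pairs outside \<beta>.\<close>
    let ?P = "\<lambda>g s. (\<forall>\<xi>\<in>elts (s 0). \<exists>y\<in>elts (s 1). kpair \<xi> y \<in> elts g \<and>
          (\<forall>y'\<in>elts (s 1). kpair \<xi> y' \<in> elts g \<longrightarrow> y' = y)) \<longrightarrow>
        (\<exists>d\<in>elts (s 2). \<forall>\<xi>\<in>elts (s 0). \<forall>y\<in>elts (s 1). kpair \<xi> y \<in> elts g \<longrightarrow> kpair \<xi> y \<in> elts d)"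
    have base: "?P g ((!) [\<beta>, A, D])" for g
    proof -
      have "\<exists>d\<in>elts D. \<forall>\<xi>\<in>elts \<beta>. \<forall>y\<in>elts A. kpair \<xi> y \<in> elts g \<longrightarrow> kpair \<xi> y \<in> elts d"
        if u: "\<forall>\<xi>\<in>elts \<beta>. \<exists>y\<in>elts A. kpair \<xi> y \<in> elts g \<and> (\<forall>y'\<in>elts A. kpair \<xi> y' \<in> elts g \<longrightarrow> y' = y)"
      proof -
        obtain h where h: "\<And>\<xi>. \<xi> \<in> elts \<beta> \<Longrightarrow> h \<xi> \<in> elts A"
          "\<And>\<xi> y. \<xi> \<in> elts \<beta> \<Longrightarrow> y \<in> elts A \<Longrightarrow> kpair \<xi> y \<in> elts g \<Longrightarrow> y = h \<xi>"
          using u by metis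
        then have "h ` elts \<beta> \<subseteq> elts A" by blast
        then obtain d where "d \<in> elts D" "\<And>\<xi>. \<xi> \<in> elts \<beta> \<Longrightarrow> fun_app d \<xi> = h \<xi>"
          using D unfolding all_functions_def by blast
        then show ?thesis using h kpair_mem_iff_fun_app[OF D0] by metis
      qed
      then show ?thesis by simp
    qed
    have "bounded_pred (\<lambda>s. ?P (s 0) (\<lambda>n. s (Suc n)))" by (intro bounded)
    from bounded_transfer_all[of ?P "(!) [\<beta>, A, D]" g, OF this base g(1)]
    have "\<exists>d\<in>elts (j D). \<forall>\<xi>\<in>elts \<beta>. \<forall>y\<in>elts (j A). kpair \<xi> y \<in> elts g \<longrightarrow> kpair \<xi> y \<in> elts d"
      using f g(2) by (simp add: fixed[OF \<beta>] image_subset_iff)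
    then obtain d where d: "d \<in> elts (j D)" "\<And>\<xi>. \<xi> \<in> elts \<beta> \<Longrightarrow> kpair \<xi> (f \<xi>) \<in> elts d"
      using f g(2) by blast
    then show ?thesis using kpair_mem_iff_fun_app[OF D'] by metis
  qed
  then show ?thesis using D' unfolding all_functions_def by blast
qed

lemma jfun_val:
  assumes M: "is_structure \<tau> M" and D: "function_set D \<beta> (dom_of M)" and \<beta>: "\<beta> \<in> elts \<eta>"
    and e: "\<And>x. e x \<in> elts \<beta>" and x: "x \<in> elts (j D)"
  shows "wf_tm \<tau> t \<Longrightarrow> jfun D (\<lambda>d. val M (\<lambda>v. fun_app d (e v)) t) x =
    val (jstruct M) (\<lambda>v. fun_app x (e v)) t"
proof (induction t)
  case (Var v)
  show ?case using jfun_fun_app[OF D e x] fixed_mem[OF \<beta> e] by simp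
next
  case (App f ts)
  let ?s = "\<lambda>d v. fun_app d (e v)"
  let ?n = "length ts"
  let ?h = "\<lambda>d. tuple_code (map (\<lambda>t. val M (?s d) t) ts)"
  have "map (val M (?s d)) ts \<in> tuples M ?n" if "d \<in> elts D" for d
    using val_in[OF M] fun_app_in[OF D that e] App.prems by (auto simp: tuples_def list_all_iff)
  then have h: "?h d \<in> elts (tuple_set (dom_of M) ?n)" if "d \<in> elts D" for d
    using that tuple_code_in_tuple_set by blast
  have "jfun D (\<lambda>d. val M (?s d) (App f ts)) x =
      jfun D (\<lambda>d. fun_int M f (tuple_decode ?n (?h d))) x"
    by simp
  also have "\<dots> = jfun (tuple_set (dom_of M) ?n) (\<lambda>c. fun_int M f (tuple_decode ?n c)) (jfun D ?h x)"
    by (rule jfun_comp[OF h x])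
  also have "jfun D ?h x = tuple_code (map (\<lambda>t. jfun D (\<lambda>d. val M (?s d) t) x) ts)"
    by (rule jfun_tuple_code[OF x])
  also have "map (\<lambda>t. jfun D (\<lambda>d. val M (?s d) t) x) ts = map (val (jstruct M) (?s x)) ts"
    using App by (auto simp: list_all_iff)
  finally show ?case by (simp add: jstruct_def)
qed

text \<open>The claim covers every \<open>x\<close> in \<open>j D\<close>, not only images
  \<open>j d\<close>, because the existential case applies the induction hypothesis to arbitrary
  witnesses in \<open>j D\<close>.\<close>

lemma jpred_sat:
  assumes M: "is_structure \<tau> M" and D: "all_functions D \<beta> (dom_of M)" and \<beta>: "\<beta> \<in> elts \<eta>"
    and e: "\<And>x. e x \<in> elts \<beta>" "inj_on e Y"
  shows "in_logic \<eta> \<tau> p \<Longrightarrow> fm_vars p \<subseteq> Y \<Longrightarrow> x \<in> elts (j D) \<Longrightarrow>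
    jpred D (\<lambda>d. sat M p (\<lambda>v. fun_app d (e v))) x \<longleftrightarrow> sat (jstruct M) p (\<lambda>v. fun_app x (e v))"
proof (induction p arbitrary: x)
  note D0 = all_functions_function_set[OF D]
  let ?s = "\<lambda>d v. fun_app d (e v)"
  case (Eq t u)
  then show ?case using jpred_eq[OF Eq.prems(3)] jfun_val[OF M D0 \<beta> e(1) Eq.prems(3)] by simp
next
  note D0 = all_functions_function_set[OF D]
  let ?s = "\<lambda>d v. fun_app d (e v)"
  case (Rel R ts)
  let ?n = "length ts"
  let ?h = "\<lambda>d. tuple_code (map (\<lambda>t. val M (?s d) t) ts)"
  have "map (val M (?s d)) ts \<in> tuples M ?n" if "d \<in> elts D" for d
    using val_in[OF M] fun_app_in[OF D0 that e(1)] Rel.prems by (auto simp: tuples_def)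
  then have h: "?h d \<in> elts (tuple_set (dom_of M) ?n)" if "d \<in> elts D" for d
    using that tuple_code_in_tuple_set by blast
  have "jpred D (\<lambda>d. sat M (Rel R ts) (?s d)) x =
      jpred D (\<lambda>d. rel_int M R (tuple_decode ?n (?h d))) x"
    by simp
  also have "\<dots> = jpred (tuple_set (dom_of M) ?n) (\<lambda>c. rel_int M R (tuple_decode ?n c)) (jfun D ?h x)"
    by (rule jpred_comp[OF h Rel.prems(3)])
  also have "jfun D ?h x = tuple_code (map (\<lambda>t. jfun D (\<lambda>d. val M (?s d) t) x) ts)"
    by (rule jfun_tuple_code[OF Rel.prems(3)])
  also have "map (\<lambda>t. jfun D (\<lambda>d. val M (?s d) t) x) ts = map (val (jstruct M) (?s x)) ts"
    using Rel.prems jfun_val[OF M D0 \<beta> e(1) Rel.prems(3)] by auto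
  finally show ?case by (simp add: jstruct_def)
next
  case (Neg p)
  then show ?case using jpred_not[OF Neg.prems(3)] by simp
next
  let ?s = "\<lambda>d v. fun_app d (e v)"
  case (Conj I F)
  then have "elts I \<prec> elts \<eta>" by simp
  \<comment> \<open>The index set \<open>I\<close> is an arbitrary small set that \<open>j\<close>
    may move; it is replaced by a set of ordinals below \<gamma> < \<eta>, which \<open>j\<close>
    fixes.\<close>
  then obtain \<gamma> g where g: "\<gamma> \<in> elts \<eta>" "inj_on g (elts I)" "g ` elts I \<subseteq> elts \<gamma>"
    using regular_bounded_injection[OF regular] by blast
  let ?X = "image_set g I"
  let ?G = "\<lambda>i. F (inv_into (elts I) g i)"
  have jX: "j ?X = ?X"
    by (rule j_fixed_subset[OF fixed[OF g(1)] fixed_mem[OF g(1)]]) (use g(3) in simp_all)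
  have ji: "j i = i" if "i \<in> elts ?X" for i
    by (rule fixed_mem[OF g(1)]) (use g(3) that in auto)
  have G: "(\<forall>i\<in>elts I. Q (F i)) \<longleftrightarrow> (\<forall>i\<in>elts ?X. Q (?G i))" for Q
    using g(2) by simp
  have "jpred D (\<lambda>d. sat M (Conj I F) (?s d)) x = jpred D (\<lambda>d. \<forall>i\<in>elts ?X. sat M (?G i) (?s d)) x"
    unfolding sat.simps by (subst G) (rule refl)
  also have "\<dots> \<longleftrightarrow> (\<forall>i\<in>elts ?X. jpred D (\<lambda>d. sat M (?G i) (?s d)) x)"
    by (rule jpred_all[OF jX ji Conj.prems(3)])
  also have "\<dots> \<longleftrightarrow> (\<forall>i\<in>elts I. jpred D (\<lambda>d. sat M (F i) (?s d)) x)"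
    by (rule G[of "\<lambda>p. jpred D (\<lambda>d. sat M p (?s d)) x", symmetric])
  also have "\<dots> \<longleftrightarrow> (\<forall>i\<in>elts I. sat (jstruct M) (F i) (?s x))"
  proof (rule ball_cong[OF refl])
    fix i assume "i \<in> elts I"
    then show "jpred D (\<lambda>d. sat M (F i) (?s d)) x = sat (jstruct M) (F i) (?s x)"
      using Conj.prems by (intro Conj.IH) auto
  qed
  finally show ?case by simp
next
  note D0 = all_functions_function_set[OF D]
  let ?s = "\<lambda>d v. fun_app d (e v)"
  case (Ex X p)
  let ?B = "image_set e X"
  have vars: "elts X \<subseteq> Y" "fv p \<subseteq> Y" using Ex.prems fv_subset_fm_vars by force+
  have jB: "j ?B = ?B"
    by (rule j_fixed_subset[OF fixed[OF \<beta>] fixed_mem[OF \<beta>]]) (use e(1) in auto)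
  have D': "all_functions (j D) \<beta> (dom_of (jstruct M))" using all_functions_j[OF D \<beta>] by simp
  have "jpred D (\<lambda>d. sat M (fm.Ex X p) (?s d)) x = jpred D (\<lambda>d. \<exists>d'\<in>elts D.
      (\<forall>\<xi>\<in>elts \<beta>. \<xi> \<in> elts ?B \<or> fun_app d' \<xi> = fun_app d \<xi>) \<and> sat M p (?s d')) x"
    by (rule fun_cong[OF jpred_cong]) (simp only: sat_Ex_coded[OF D e vars] elts_image_set)
  also have "\<dots> \<longleftrightarrow> (\<exists>x'\<in>elts (j D). (\<forall>\<xi>\<in>elts \<beta>. \<xi> \<in> elts ?B \<or> fun_app x' \<xi> = fun_app x \<xi>) \<and>
      jpred D (\<lambda>d. sat M p (?s d)) x')"
    using jpred_ex[OF D0 Ex.prems(3), of ?B] by (simp only: jB fixed[OF \<beta>])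
  also have "\<dots> \<longleftrightarrow> (\<exists>x'\<in>elts (j D). (\<forall>\<xi>\<in>elts \<beta>. \<xi> \<in> e ` elts X \<or> fun_app x' \<xi> = fun_app x \<xi>) \<and>
      sat (jstruct M) p (?s x'))"
    using Ex.IH Ex.prems by auto
  also have "\<dots> \<longleftrightarrow> sat (jstruct M) (fm.Ex X p) (?s x)"
    using sat_Ex_coded[OF D' e vars Ex.prems(3)] by blast
  finally show ?case .
qed

lemma sat_jstruct:
  assumes M: "is_structure \<tau> M" and p: "in_logic \<eta> \<tau> p" and s: "\<And>x. s x \<in> elts (dom_of M)"
  shows "sat (jstruct M) p (\<lambda>x. j (s x)) \<longleftrightarrow> sat M p s"
proof -
  \<comment> \<open>Quantifying over one more variable makes the set of variables nonempty, so that
    \<beta> is nonempty and \<open>e\<close> has the default value \<open>e0 x0\<close>.\<close>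
  obtain x0 :: 'v where "x0 = x0" by blast
  let ?p = "fm.Ex (set_of {x0}) p"
  have "in_logic \<eta> \<tau> ?p"
    using p regular by (auto simp: regular_Card_def intro: finite_lesspoll_infinite)
  then obtain \<beta> e0 where e0: "\<beta> \<in> elts \<eta>" "inj_on e0 (fm_vars ?p)" "e0 ` fm_vars ?p \<subseteq> elts \<beta>"
    using regular_bounded_injection[OF regular fm_vars_lesspoll[OF regular]] by blast
  define e where "e x = (if x \<in> fm_vars ?p then e0 x else e0 x0)" for x
  have e: "e x \<in> elts \<beta>" for x using e0(3) by (auto simp: e_def)
  have inj: "inj_on e (fm_vars p)" using e0(2) by (auto simp: e_def inj_on_def)
  obtain D where D: "all_functions D \<beta> (dom_of M)" using all_functions_exist by blast
  \<comment> \<open>Outside the range of \<open>e\<close> the inverse is arbitrary, but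
    \<open>s\<close> takes values in the domain everywhere, so this is a function from \<beta> to
    the domain that codes \<open>s\<close> on the variables of \<open>p\<close>.\<close>
  have "(\<lambda>\<xi>. s (inv_into (fm_vars p) e \<xi>)) ` elts \<beta> \<subseteq> elts (dom_of M)" using s by blast
  then obtain d where d: "d \<in> elts D"
    "\<And>\<xi>. \<xi> \<in> elts \<beta> \<Longrightarrow> fun_app d \<xi> = s (inv_into (fm_vars p) e \<xi>)"
    using D unfolding all_functions_def by metis
  have ds: "fun_app d (e x) = s x" if "x \<in> fm_vars p" for x
    using d(2)[OF e] inj that by simp
  then have ds: "fun_app d (e x) = s x" if "x \<in> fv p" for x
    using that fv_subset_fm_vars[of p] by blast
  have jd: "fun_app (j d) (e x) = j (fun_app d (e x))" for x
    using jfun_fun_app[OF all_functions_function_set[OF D] e, of "j d" x]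
      jfun_j[OF d(1)] fixed_mem[OF e0(1) e] d(1) by simp
  have "sat M p s \<longleftrightarrow> sat M p (\<lambda>x. fun_app d (e x))"
    by (rule sat_cong) (simp add: ds)
  also have "\<dots> \<longleftrightarrow> sat (jstruct M) p (\<lambda>x. fun_app (j d) (e x))"
    using jpred_sat[OF M D e0(1) e inj p, of "j d"] d(1) by (simp add: jpred_j)
  also have "\<dots> \<longleftrightarrow> sat (jstruct M) p (\<lambda>x. j (s x))"
    by (rule sat_cong) (simp add: ds jd)
  finally show ?thesis by simp
qed

end

section \<open>Transport of a structure along an injection\<close>

definition image_struct :: "('v::set_universe \<Rightarrow> 'v) \<Rightarrow> 'v struct \<Rightarrow> 'v struct" where
  "image_struct h K = \<lparr>dom_of = image_set h (dom_of K),
     rel_int = \<lambda>R ys. rel_int K R (map (inv_into (elts (dom_of K)) h) ys),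
     fun_int = \<lambda>f ys. h (fun_int K f (map (inv_into (elts (dom_of K)) h) ys))\<rparr>"

lemma dom_image_struct [simp]: "dom_of (image_struct h K) = image_set h (dom_of K)"
  by (simp add: image_struct_def)

lemma map_inv_into_map:
  "inj_on h A \<Longrightarrow> set xs \<subseteq> A \<Longrightarrow> map (inv_into A h) (map h xs) = xs"
  by (induction xs) auto

lemma image_struct_interp:
  assumes "inj_on h (elts (dom_of K))" "set xs \<subseteq> elts (dom_of K)"
  shows "rel_int (image_struct h K) R (map h xs) = rel_int K R xs"
    and "fun_int (image_struct h K) f (map h xs) = h (fun_int K f xs)"
  unfolding image_struct_def by (simp_all only: struct.simps map_inv_into_map[OF assms])

lemma is_structure_image_struct:
  assumes K: "is_structure \<tau> K" and h: "inj_on h (elts (dom_of K))"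
  shows "is_structure \<tau> (image_struct h K)"
proof -
  have "fun_int (image_struct h K) f ys \<in> h ` elts (dom_of K)"
    if "f \<in> elts (fun_syms \<tau>)" "ys \<in> tuples (image_struct h K) (fun_arity \<tau> f)" for f ys
  proof -
    have "ys \<in> lists (h ` elts (dom_of K))" using that(2) by (auto simp: tuples_def)
    then obtain xs where xs: "ys = map h xs" "set xs \<subseteq> elts (dom_of K)"
      unfolding lists_image by auto
    then have "xs \<in> tuples K (fun_arity \<tau> f)" using that(2) by (simp add: tuples_def)
    then have "fun_int K f xs \<in> elts (dom_of K)" using K that(1) by (simp add: is_structure_def)
    then show ?thesis using image_struct_interp(2)[OF h xs(2)] xs(1) by simp
  qed
  then show ?thesis using K by (simp add: is_structure_def)
qed

lemma val_image_struct:
  assumes K: "is_structure \<tau> K" and h: "inj_on h (elts (dom_of K))"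
    and s: "\<And>x. s x \<in> elts (dom_of K)"
  shows "wf_tm \<tau> t \<Longrightarrow> val (image_struct h K) (\<lambda>x. h (s x)) t = h (val K s t)"
proof (induction t)
  case (App f ts)
  have ts: "set (map (val K s) ts) \<subseteq> elts (dom_of K)"
    using App.prems val_in[OF K _ s] by (auto simp: list_all_iff)
  have "map (val (image_struct h K) (\<lambda>x. h (s x))) ts = map h (map (val K s) ts)"
    using App by (simp add: list_all_iff)
  then show ?case using image_struct_interp(2)[OF h ts] by (simp only: val.simps)
qed simp

lemma sat_image_struct:
  assumes K: "is_structure \<tau> K" and h: "inj_on h (elts (dom_of K))"
  shows "in_logic \<eta> \<tau> p \<Longrightarrow> (\<And>x. s x \<in> elts (dom_of K)) \<Longrightarrow>
    sat (image_struct h K) p (\<lambda>x. h (s x)) \<longleftrightarrow> sat K p s"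
proof (induction p arbitrary: s)
  case (Eq t u)
  then have "val K s t \<in> elts (dom_of K)" "val K s u \<in> elts (dom_of K)"
    using val_in[OF K] by auto
  then show ?case
    using Eq h val_image_struct[OF K h Eq.prems(2)] by (simp add: inj_on_eq_iff)
next
  case (Rel R ts)
  have ts: "set (map (val K s) ts) \<subseteq> elts (dom_of K)"
    using Rel.prems val_in[OF K _ Rel.prems(2)] by auto
  have "map (val (image_struct h K) (\<lambda>x. h (s x))) ts = map h (map (val K s) ts)"
    using Rel.prems(1) val_image_struct[OF K h Rel.prems(2)] by simp
  then show ?case using image_struct_interp(1)[OF h ts] by (simp only: sat.simps)
next
  case (Ex X p)
  let ?K = "image_struct h K"
  show ?case
  proof
    assume "sat ?K (fm.Ex X p) (\<lambda>x. h (s x))"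
    then obtain s' where s': "\<And>x. x \<in> elts X \<Longrightarrow> s' x \<in> h ` elts (dom_of K)"
      "\<And>x. x \<notin> elts X \<Longrightarrow> s' x = h (s x)" "sat ?K p s'"
      by auto
    \<comment> \<open>The witnessing assignment is pulled back along \<open>h\<close> on the
      quantified variables.\<close>
    define t where "t x = (if x \<in> elts X then inv_into (elts (dom_of K)) h (s' x) else s x)" for x
    have t: "t x \<in> elts (dom_of K)" for x
      using s'(1) Ex.prems(2) by (simp add: t_def inv_into_into)
    have "s' x = h (t x)" for x
      using s'(1,2) by (cases "x \<in> elts X") (simp_all add: t_def f_inv_into_f)
    then have "s' = (\<lambda>x. h (t x))" by blast
    then have "sat K p t" using s'(3) Ex.IH[OF _ t] Ex.prems(1) by simp
    then show "sat K (fm.Ex X p) s"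
      unfolding sat.simps by (intro exI[of _ t]) (simp add: t, simp add: t_def)
  next
    assume "sat K (fm.Ex X p) s"
    then obtain t where t: "\<And>x. x \<in> elts X \<Longrightarrow> t x \<in> elts (dom_of K)"
      "\<And>x. x \<notin> elts X \<Longrightarrow> t x = s x" "sat K p t"
      by auto
    have "t x \<in> elts (dom_of K)" for x using t(1,2) Ex.prems(2) by (cases "x \<in> elts X") simp_all
    then have "sat ?K p (\<lambda>x. h (t x))" using t(3) Ex.IH Ex.prems(1) by simp
    then show "sat ?K (fm.Ex X p) (\<lambda>x. h (s x))"
      unfolding sat.simps by (intro exI[of _ "\<lambda>x. h (t x)"]) (simp add: t)
  qed
qed auto

section \<open>Turning the embedding into an inclusion\<close>

text \<open>Membership would close the cycle \<open>A \<in> {y, A} \<in> kpair y A \<in> A\<close>,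
  against foundation. Such pairs supply names outside \<open>A\<close>.\<close>

lemma kpair_notin: "kpair y A \<notin> elts (A :: 'v::set_universe)"
proof
  let ?r = "{(x, y). x \<in> elts (y :: 'v)}"
  assume "kpair y A \<in> elts A"
  then have "(kpair y A, A) \<in> ?r\<^sup>+" by (intro r_into_trancl) simp
  moreover have "(set_of {y, A}, kpair y A) \<in> ?r\<^sup>+"
    by (intro r_into_trancl) (simp add: kpair_def)
  moreover have "(A, set_of {y, A}) \<in> ?r\<^sup>+" by (intro r_into_trancl) simp
  ultimately have "(A, A) \<in> ?r\<^sup>+" by (meson trancl_trans)
  then show False using wf_acyclic[OF foundation[where 'a='v]] unfolding acyclic_def by blast
qed

context embedding
begin

text \<open>Each \<open>j x\<close> with \<open>x\<close> in \<open>A\<close> is renamed back to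
  \<open>x\<close>, and every other element gets a name outside \<open>A\<close>. The renamed image
  then literally extends the original structure.\<close>

definition collapse :: "'v \<Rightarrow> 'v \<Rightarrow> 'v" where
  "collapse A y = (if y \<in> j ` elts A then inv j y else kpair y A)"

lemma collapse_j [simp]: "x \<in> elts A \<Longrightarrow> collapse A (j x) = x"
  by (simp add: collapse_def inj_def)

lemma inj_collapse: "inj_on (collapse A) X"
proof (rule inj_onI)
  fix y z assume eq: "collapse A y = collapse A z"
  show "y = z"
  proof (cases "y \<in> j ` elts A")
    case True
    then obtain a where a: "a \<in> elts A" "y = j a" by blast
    then have "collapse A z \<in> elts A" using eq by simp
    then have "z \<in> j ` elts A" using kpair_notin by (auto simp: collapse_def split: if_splits)
    then show ?thesis using a eq by auto
  next
    case False
    then have "collapse A y \<notin> elts A" using kpair_notin by (simp add: collapse_def)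
    then have "collapse A z \<notin> elts A" using eq by simp
    then have "z \<notin> j ` elts A" by auto
    then show ?thesis using False eq by (simp add: collapse_def)
  qed
qed

end

context closed_embedding
begin

lemma elementary_extension:
  assumes M: "is_structure \<tau> M"
  shows "\<exists>M'. is_structure \<tau> M' \<and> elem_substructure \<eta> \<tau> M M' \<and>
    elts (dom_of M') \<approx> elts (j (dom_of M))"
proof -
  let ?h = "collapse (dom_of M)"
  let ?M' = "image_struct ?h (jstruct M)"
  have jM: "is_structure \<tau> (jstruct M)" by (rule is_structure_jstruct[OF M])
  have hj: "map ?h (map j xs) = xs" if "set xs \<subseteq> elts (dom_of M)" for xs
    using that by (induction xs) auto
  have dom: "elts (dom_of M) \<subseteq> elts (dom_of ?M')"
  proof
    fix x assume "x \<in> elts (dom_of M)"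
    then show "x \<in> elts (dom_of ?M')" by (auto intro!: image_eqI[of _ ?h "j x"])
  qed
  have sub: "set (map j xs) \<subseteq> elts (dom_of (jstruct M))" "set xs \<subseteq> elts (dom_of M)"
    if "xs \<in> tuples M n" for xs n
    using that by (auto simp: tuples_def)
  have rel: "rel_int ?M' R xs = rel_int M R xs" if xs: "xs \<in> tuples M n" for R xs n
    using image_struct_interp(1)[OF inj_collapse sub(1)[OF xs], of "dom_of M" R]
      rel_int_jstruct_j[OF xs] hj[OF sub(2)[OF xs]] by (simp only:)
  have func: "fun_int ?M' f xs = fun_int M f xs"
    if xs: "xs \<in> tuples M n" and f: "fun_int M f xs \<in> elts (dom_of M)" for f xs n
    using image_struct_interp(2)[OF inj_collapse sub(1)[OF xs], of "dom_of M" f]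
      fun_int_jstruct_j[OF xs] hj[OF sub(2)[OF xs]] collapse_j[OF f] by (simp only:)
  have "substructure \<tau> M ?M'"
    unfolding substructure_def
    using dom rel func M unfolding is_structure_def by metis
  moreover have "sat M p s \<longleftrightarrow> sat ?M' p s" if "in_logic \<eta> \<tau> p" "range s \<subseteq> elts (dom_of M)" for p s
  proof -
    have s: "s x \<in> elts (dom_of M)" for x using that(2) by blast
    have "sat M p s \<longleftrightarrow> sat (jstruct M) p (\<lambda>x. j (s x))"
      using sat_jstruct[OF M that(1) s] by simp
    also have "\<dots> \<longleftrightarrow> sat ?M' p (\<lambda>x. ?h (j (s x)))"
      using sat_image_struct[OF jM inj_collapse that(1), of "\<lambda>x. j (s x)" "dom_of M"] s
      by (simp del: collapse_j)
    also have "\<dots> \<longleftrightarrow> sat ?M' p s" using s by simp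
    finally show ?thesis .
  qed
  ultimately have "elem_substructure \<eta> \<tau> M ?M'" unfolding elem_substructure_def by blast
  moreover have "elts (dom_of ?M') \<approx> elts (j (dom_of M))"
    using inj_on_image_eqpoll_self[OF inj_collapse] by simp
  moreover have "is_structure \<tau> ?M'" by (rule is_structure_image_struct[OF jM inj_collapse])
  ultimately show ?thesis by blast
qed

end

section \<open>Loewenheim-Skolem-Tarski numbers\<close>

lemma elts_seq: "kpair \<xi> y \<in> elts (seq \<alpha> f) \<longleftrightarrow> \<xi> \<in> elts \<alpha> \<and> y = f \<xi>"
  using kpair_in_graph unfolding seq_def graph_def .

text \<open>The given larger cardinal \<gamma>' is used as \<theta>. The extension has the size of
  \<open>j \<gamma>\<close>, and \<gamma>' belongs to \<open>j \<kappa>\<close>, which is at most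
  \<open>j \<gamma>\<close>.\<close>

lemma SULST_property_of_embeddings:
  fixes \<eta> \<kappa> :: "'v::set_universe"
  assumes \<kappa>: "is_Card \<kappa>" and le: "ord_le \<eta> \<kappa>"
    and emb: "\<And>\<theta>. is_Ord \<theta> \<Longrightarrow> \<kappa> \<in> elts \<theta> \<Longrightarrow>
      \<exists>j N. closed_embedding j N \<eta> \<and> \<theta> \<in> elts (j \<kappa>)"
  shows "SULST_property \<eta> \<kappa>"
proof -
  have "\<exists>M' \<mu>. is_structure \<tau> M' \<and> has_card (dom_of M') \<mu> \<and> ord_le \<gamma>' \<mu> \<and> elem_substructure \<eta> \<tau> M M'"
    if M: "is_structure \<tau> M" and \<gamma>: "has_card (dom_of M) \<gamma>" "ord_le \<kappa> \<gamma>"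
      and \<gamma>': "is_Card \<gamma>'" "\<gamma> \<in> elts \<gamma>'" for \<tau> M \<gamma> \<gamma>'
  proof -
    have ord: "is_Ord \<gamma>'" "is_Ord \<gamma>"
      using \<gamma>(1) \<gamma>'(1) is_Card_Ord unfolding has_card_def by blast+
    have "\<kappa> \<in> elts \<gamma>'" using \<gamma>(2) \<gamma>'(2) is_Ord_trans[OF ord(1)] unfolding ord_le_def by blast
    then obtain j N where jN: "closed_embedding j N \<eta>" "\<gamma>' \<in> elts (j \<kappa>)"
      using emb[OF ord(1)] by blast
    interpret closed_embedding j N \<eta> by (rule jN(1))
    obtain b where "bij_betw b (elts (dom_of M)) (elts \<gamma>)"
      using \<gamma>(1) unfolding has_card_def eqpoll_def by blast
    then have "elts (j (dom_of M)) \<approx> elts (j \<gamma>)"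
      unfolding eqpoll_def using jfun_bij_betw by blast
    moreover obtain M' where M': "is_structure \<tau> M'" "elem_substructure \<eta> \<tau> M M'"
      "elts (dom_of M') \<approx> elts (j (dom_of M))"
      using elementary_extension[OF M] by blast
    moreover have j\<gamma>: "is_Ord (j \<gamma>)" using ord(2) j_Ord_iff by blast
    then obtain \<mu> where \<mu>: "has_card (j \<gamma>) \<mu>" using Ord_has_card by blast
    ultimately have "has_card (dom_of M') \<mu>" unfolding has_card_def using eqpoll_trans by blast
    moreover have "ord_le \<gamma>' \<mu>"
    proof (rule Card_le_of_lepoll[OF \<gamma>'(1)])
      show "is_Ord \<mu>" using \<mu> is_Card_Ord unfolding has_card_def by blast
      have "\<gamma>' \<in> elts (j \<gamma>)"
        using jN(2) \<gamma>(2) is_Ord_trans[OF j\<gamma>, of "j \<kappa>" \<gamma>'] unfolding ord_le_def by auto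
      then have "elts \<gamma>' \<lesssim> elts (j \<gamma>)"
        using ord_le_subset[OF j\<gamma>] subset_imp_lepoll unfolding ord_le_def by blast
      then show "elts \<gamma>' \<lesssim> elts \<mu>" using \<mu> lepoll_trans2 unfolding has_card_def by blast
    qed
    ultimately show ?thesis using M' by blast
  qed
  then show ?thesis using \<kappa> unfolding SULST_property_def by blast
qed

lemma SULST_property_of_tall_closure:
  assumes "regular_Card \<eta>" "ord_le \<eta> \<kappa>" "tall_closure \<kappa> \<eta>" shows "SULST_property \<eta> \<kappa>"
proof (rule SULST_property_of_embeddings)
  show \<kappa>: "is_Card \<kappa>" using assms(3) by (simp add: tall_closure_def)
  fix \<theta> assume "is_Ord \<theta>" "\<kappa> \<in> elts \<theta>"
  then obtain j N where jN: "transitive_class N" "elementary_embedding j N" "critical_point j \<kappa>"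
    "\<theta> \<in> elts (j \<kappa>)" "\<And>\<alpha>. \<alpha> \<in> elts \<eta> \<Longrightarrow> closed_seq N \<alpha>"
    using assms(3) unfolding tall_closure_def by meson
  \<comment> \<open>Every ordinal below \<eta> is thereby below the critical point and fixed by
    \<open>j\<close>.\<close>
  have "elts \<eta> \<subseteq> elts \<kappa>" using ord_le_subset[OF is_Card_Ord[OF \<kappa>] assms(2)] .
  then have "closed_embedding j N \<eta>"
  proof (unfold_locales, goal_cases)
    \<comment> \<open>Goal 5 is the closure axiom of \<open>closed_embedding\<close>; the sequence
      itself serves as \<open>g\<close>.\<close>
    case (5 \<beta> f)
    then have "seq \<beta> f \<in> N" using jN(5) unfolding closed_seq_def by blast
    then show ?case by (intro bexI[of _ "seq \<beta> f"]) (simp_all add: elts_seq)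
  qed (use jN assms(1) in \<open>auto simp: critical_point_def\<close>)
  then show "\<exists>j N. closed_embedding j N \<eta> \<and> \<theta> \<in> elts (j \<kappa>)" using jN(4) by blast
qed (rule assms(2))

section \<open>Regularity of the critical point\<close>

context embedding
begin

text \<open>Rules out a finite critical point: its members are fixed, so it would be fixed
  too.\<close>

lemma j_finite_fixed:
  "finite X \<Longrightarrow> elts y = X \<Longrightarrow> (\<And>x. x \<in> X \<Longrightarrow> j x = x) \<Longrightarrow> j y = y"
proof (induction X arbitrary: y rule: finite_induct)
  case empty
  then have "y = set_of {}" by (intro extensionality) simp
  then show ?case using j_empty by simp
next
  case (insert a X)
  let ?z = "set_of X"
  have z: "elts ?z = X" using insert.prems(1) by (intro elts_set_of small_subset[OF small_elts[of y]]) auto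
  have jz: "j ?z = ?z" using insert.IH[OF z] insert.prems(2) by simp
  let ?P = "\<lambda>y a z. a \<in> elts y \<and> (\<forall>t\<in>elts z. t \<in> elts y) \<and> (\<forall>t\<in>elts y. t = a \<or> t \<in> elts z)"
  have bnd: "bounded_pred (\<lambda>s. ?P (s 0) (s 1) (s 2))" by (intro bounded)
  have "?P (j y) (j a) (j ?z)"
    by (rule iffD1[OF transfer3[of ?P y a ?z, OF bnd]]) (simp add: z insert.prems(1))
  then have "?P (j y) a ?z" using jz insert.prems(2) by simp
  then have "elts (j y) = insert a X" using z by blast
  then show ?case using insert.prems(1) by (intro extensionality) simp
qed

text \<open>An unbounded \<open>X\<close> in \<kappa> of smaller size is enumerated along an ordinal
  \<open>l < \<kappa>\<close>. Since \<open>j\<close> fixes \<open>l\<close>, its members and the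
  values, it fixes \<open>X\<close>. But \<open>j X\<close> is unbounded in
  \<open>j \<kappa>\<close>, while \<open>X\<close> is bounded there by \<kappa>.\<close>

lemma critical_point_regular:
  assumes \<kappa>: "is_Card \<kappa>" and crit: "critical_point j \<kappa>" shows "regular_Card \<kappa>"
proof -
  have ord: "is_Ord \<kappa>" using \<kappa> by (rule is_Card_Ord)
  have fixd: "j \<xi> = \<xi>" if "\<xi> \<in> elts \<kappa>" for \<xi> using crit that unfolding critical_point_def by blast
  have neq: "j \<kappa> \<noteq> \<kappa>" using crit unfolding critical_point_def by blast
  have "infinite (elts \<kappa>)" using j_finite_fixed[OF _ refl fixd] neq by blast
  moreover have "\<exists>\<beta>\<in>elts \<kappa>. X \<subseteq> elts \<beta>" if X: "X \<subseteq> elts \<kappa>" "X \<prec> elts \<kappa>" for X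
  proof (rule ccontr)
    assume unb: "\<not> ?thesis"
    let ?x = "set_of X"
    have x: "elts ?x = X" using X(1) by (intro elts_set_of small_subset[OF small_elts])
    obtain l where l: "is_Ord l" "ord_le l \<kappa>" "X \<approx> elts l"
      using subset_Ord_eqpoll_Ord[OF ord X(1)] by blast
    have "l \<noteq> \<kappa>" using l(3) X(2) unfolding lesspoll_def by blast
    then have l\<kappa>: "l \<in> elts \<kappa>" using l(2) unfolding ord_le_def by blast
    obtain h where h: "bij_betw h (elts l) (elts ?x)"
      using eqpoll_sym[OF l(3)] x unfolding eqpoll_def by auto
    have "jfun l h \<xi> = h \<xi>" if "\<xi> \<in> elts l" for \<xi>
    proof -
      have "j \<xi> = \<xi>" using fixd is_Ord_trans[OF ord l\<kappa> that] by blast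
      moreover have "j (h \<xi>) = h \<xi>" using bij_betwE[OF h] that x X(1) fixd by blast
      ultimately show ?thesis using jfun_j[OF that, of h] by simp
    qed
    then have "jfun l h ` elts (j l) = h ` elts l" using fixd[OF l\<kappa>] by simp
    then have jx: "elts (j ?x) = X"
      using jfun_bij_betw[OF h] h x unfolding bij_betw_def by simp
    have "elts \<kappa> \<subseteq> elts (j \<kappa>)"
    proof
      fix \<xi> assume "\<xi> \<in> elts \<kappa>"
      then show "\<xi> \<in> elts (j \<kappa>)" using j_mem_iff[of \<xi> \<kappa>] fixd by simp
    qed
    then have "ord_le \<kappa> (j \<kappa>)" using subset_ord_le[OF ord] ord j_Ord_iff by blast
    then have \<kappa>j: "\<kappa> \<in> elts (j \<kappa>)" using neq unfolding ord_le_def by auto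
    let ?P = "\<lambda>k y. \<forall>\<beta>\<in>elts k. \<exists>x\<in>elts y. x \<notin> elts \<beta>"
    have bnd: "bounded_pred (\<lambda>s. ?P (s 0) (s 1))" by (intro bounded)
    have "?P (j \<kappa>) (j ?x)"
      by (rule iffD1[OF transfer2[of ?P \<kappa> ?x, OF bnd]]) (use unb x in blast)
    then show False using \<kappa>j jx X(1) by blast
  qed
  ultimately show ?thesis using \<kappa> unfolding regular_Card_def by blast
qed

end

lemma tall_regular:
  assumes "tall \<kappa>" shows "regular_Card \<kappa>"
proof -
  have \<kappa>: "is_Card \<kappa>" using assms by (simp add: tall_def)
  obtain \<theta> where "is_Ord \<theta>" "\<kappa> \<in> elts \<theta>" using is_Ord_succ[OF is_Card_Ord[OF \<kappa>]] by blast
  then obtain j N where jN: "transitive_class N" "elementary_embedding j N" "critical_point j \<kappa>"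
    using assms unfolding tall_def by meson
  interpret embedding j N by unfold_locales (use jN in auto)
  show ?thesis by (rule critical_point_regular[OF \<kappa> jN(3)])
qed

lemma SULST_property_of_tall:
  assumes "tall \<kappa>" shows "SULST_property \<kappa> \<kappa>"
proof (rule SULST_property_of_embeddings)
  show \<kappa>: "is_Card \<kappa>" using assms by (simp add: tall_def)
  fix \<theta> assume "is_Ord \<theta>" "\<kappa> \<in> elts \<theta>"
  then obtain j N where jN: "transitive_class N" "elementary_embedding j N" "critical_point j \<kappa>"
    "\<theta> \<in> elts (j \<kappa>)" "closed_seq N \<kappa>"
    using assms unfolding tall_def by meson
  have "j \<kappa> \<in> N" using jN(2) unfolding elementary_embedding_def by blast
  have "closed_embedding j N \<kappa>"
  proof (unfold_locales, goal_cases)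
    case (5 \<beta> f)
    \<comment> \<open>Closure is given for length \<kappa>, so the shorter sequence is padded with
      the element \<open>j \<kappa>\<close> of \<open>N\<close>; the padded sequence has the right
      values on \<beta>.\<close>
    let ?f = "\<lambda>\<xi>. if \<xi> \<in> elts \<beta> then f \<xi> else j \<kappa>"
    have sub: "elts \<beta> \<subseteq> elts \<kappa>" using 5(1) is_Ord_trans[OF is_Card_Ord[OF \<kappa>]] by blast
    have "?f ` elts \<kappa> \<subseteq> N" using 5(2) \<open>j \<kappa> \<in> N\<close> by auto
    then have "seq \<kappa> ?f \<in> N" using jN(5) unfolding closed_seq_def by blast
    moreover have "\<forall>\<xi>\<in>elts \<beta>. \<forall>y. kpair \<xi> y \<in> elts (seq \<kappa> ?f) \<longleftrightarrow> y = f \<xi>"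
      using sub by (simp add: elts_seq subset_iff)
    ultimately show ?case by blast
  qed (use jN tall_regular[OF assms] in \<open>auto simp: critical_point_def\<close>)
  then show "\<exists>j N. closed_embedding j N \<kappa> \<and> \<theta> \<in> elts (j \<kappa>)" using jN(4) by blast
qed (simp add: ord_le_def)

lemma SULST_imp_ULST_property:
  assumes "SULST_property \<eta> \<delta>" shows "ULST_property \<eta> \<delta>"
proof -
  have "models M' p"
    if M: "is_structure \<tau> M" and p: "in_logic \<eta> \<tau> p" "fv p = {}" "models M p"
      and M': "elem_substructure \<eta> \<tau> M M'" for \<tau> M p M'
  proof -
    obtain a where a: "a \<in> elts (dom_of M)" using M unfolding is_structure_def by blast
    then have ra: "range (\<lambda>_. a) \<subseteq> elts (dom_of M)" by simp
    have "sat M p (\<lambda>_. a)" by (rule p(3)[unfolded models_def, rule_format, OF ra])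
    then have "sat M' p (\<lambda>_. a)" using p(1) M' ra unfolding elem_substructure_def by blast
    \<comment> \<open>Without free variables the assignment does not matter, so assignments into the
      larger domain reduce to a constant one into \<open>M\<close>.\<close>
    moreover have "sat M' p s = sat M' p (\<lambda>_. a)" for s by (rule sat_cong) (simp add: p(2))
    ultimately show ?thesis unfolding models_def by simp
  qed
  moreover have "substructure \<tau> M M'" if "elem_substructure \<eta> \<tau> M M'" for \<tau> M M'
    using that unfolding elem_substructure_def by blast
  ultimately show ?thesis
    using assms unfolding SULST_property_def ULST_property_def by meson
qed

text \<open>A structure of size \<open>\<gamma> < \<kappa>\<close> in which every element is named by a constant is not extendible:
  the sentence that every element is the value of a constant lies in the logic.\<close>

lemma ULST_property_imp_ord_le:
  fixes \<kappa> :: "'v::set_universe"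
  assumes \<kappa>: "is_Card \<kappa>" and inf: "infinite (elts \<kappa>)" and U: "ULST_property \<kappa> \<delta>"
  shows "ord_le \<kappa> \<delta>"
proof (rule ccontr)
  assume neg: "\<not> ord_le \<kappa> \<delta>"
  have ord: "is_Ord \<kappa>" using \<kappa> by (rule is_Card_Ord)
  have \<delta>: "is_Card \<delta>" using U unfolding ULST_property_def by blast
  have \<delta>\<kappa>: "\<delta> \<in> elts \<kappa>"
    using neg is_Ord_linear[OF ord is_Card_Ord[OF \<delta>]] unfolding ord_le_def by blast
  \<comment> \<open>The cardinal \<gamma> will be the domain of a structure and so must be nonempty;
    if \<delta> is zero, the ordinal one is taken.\<close>
  have "\<exists>\<gamma>. is_Card \<gamma> \<and> \<gamma> \<in> elts \<kappa> \<and> ord_le \<delta> \<gamma> \<and> elts \<gamma> \<noteq> {}"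
  proof (cases "elts \<delta> = {}")
    case False
    then show ?thesis using \<delta> \<delta>\<kappa> unfolding ord_le_def by blast
  next
    case True
    let ?o = "set_of {\<delta>}"
    have "elts ?o = {\<delta>}" by simp
    then have "is_Card ?o" using True
      by (auto simp: is_Card_def is_Ord_def transitive_class_def dest: eqpoll_sym)
    moreover have "?o \<in> elts \<kappa>"
    proof -
      have "\<not> elts \<kappa> \<subseteq> elts ?o"
      proof
        assume "elts \<kappa> \<subseteq> elts ?o"
        moreover have "finite (elts ?o)" by simp
        ultimately show False using inf finite_subset by blast
      qed
      then show ?thesis
        using is_Ord_linear[OF ord is_Card_Ord[OF calculation]]
          is_Ord_trans[OF is_Card_Ord[OF calculation]] by blast
    qed
    ultimately show ?thesis by (intro exI[of _ ?o]) (simp add: ord_le_def)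
  qed
  then obtain \<gamma> where \<gamma>: "is_Card \<gamma>" "\<gamma> \<in> elts \<kappa>" "ord_le \<delta> \<gamma>" "elts \<gamma> \<noteq> {}" by blast
  have less: "elts \<gamma> \<prec> elts \<kappa>" by (rule Card_mem_lesspoll[OF \<kappa> \<gamma>(2)])
  \<comment> \<open>The members of \<gamma> are both the elements of the structure and the
    constants, each naming itself.\<close>
  define \<tau> :: "'v vocab" where
    "\<tau> = \<lparr>rel_syms = set_of {}, fun_syms = \<gamma>, rel_arity = \<lambda>_. 0, fun_arity = \<lambda>_. 0\<rparr>"
  define M :: "'v struct" where
    "M = \<lparr>dom_of = \<gamma>, rel_int = \<lambda>_ _. False, fun_int = \<lambda>f _. f\<rparr>"
  \<comment> \<open>The set \<gamma> also serves as the name of the single variable. The conjunction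
    has \<gamma> < \<kappa> members, as the logic requires.\<close>
  define p where
    "p = Neg (fm.Ex (set_of {\<gamma>}) (Conj \<gamma> (\<lambda>a. Neg (Eq (Var \<gamma>) (App a [])))))"
  have sat_p: "sat K p s \<longleftrightarrow> (\<forall>x\<in>elts (dom_of K). \<exists>a\<in>elts \<gamma>. x = fun_int K a [])" for K s
  proof -
    have "(\<exists>s'. s' \<gamma> \<in> elts (dom_of K) \<and> (\<forall>x. x \<noteq> \<gamma> \<longrightarrow> s' x = s x) \<and> Q (s' \<gamma>)) \<longleftrightarrow>
        (\<exists>x\<in>elts (dom_of K). Q x)" for Q
    proof
      assume "\<exists>x\<in>elts (dom_of K). Q x"
      then obtain x where "x \<in> elts (dom_of K)" "Q x" by blast
      then show "\<exists>s'. s' \<gamma> \<in> elts (dom_of K) \<and> (\<forall>x. x \<noteq> \<gamma> \<longrightarrow> s' x = s x) \<and> Q (s' \<gamma>)"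
        by (intro exI[of _ "s(\<gamma> := x)"]) simp
    qed blast
    from this[of "\<lambda>x. \<forall>a\<in>elts \<gamma>. x \<noteq> fun_int K a []"] show ?thesis by (simp add: p_def)
  qed
  have "is_structure \<tau> M" using \<gamma>(4) by (simp add: is_structure_def \<tau>_def M_def)
  moreover have "in_logic \<kappa> \<tau> p"
    using less inf by (simp add: p_def \<tau>_def finite_lesspoll_infinite)
  moreover have "fv p = {}" by (auto simp: p_def)
  moreover have "models M p" by (simp add: models_def sat_p M_def)
  moreover have "has_card (dom_of M) \<gamma>" using \<gamma>(1) by (simp add: has_card_def M_def)
  \<comment> \<open>The larger cardinal required by \<open>ULST_property\<close> is \<kappa>
    itself.\<close>
  ultimately obtain M' \<mu> where M': "is_structure \<tau> M'" "models M' p" "has_card (dom_of M') \<mu>"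
    "ord_le \<kappa> \<mu>"
    using U \<kappa> \<gamma>(2,3) unfolding ULST_property_def by blast
  obtain b where "b \<in> elts (dom_of M')" using M'(1) by (auto simp: is_structure_def)
  then have "sat M' p (\<lambda>_. b)" using M'(2) by (auto simp: models_def)
  then have "elts (dom_of M') \<subseteq> (\<lambda>a. fun_int M' a []) ` elts \<gamma>" using sat_p by blast
  then have "elts (dom_of M') \<lesssim> elts \<gamma>" by (rule subset_image_lepoll)
  moreover have "elts \<kappa> \<lesssim> elts \<mu>"
    using M'(3,4) ord_le_subset is_Card_Ord subset_imp_lepoll unfolding has_card_def by blast
  moreover have "elts \<mu> \<lesssim> elts (dom_of M')"
    using M'(3) eqpoll_sym eqpoll_imp_lepoll unfolding has_card_def by blast
  ultimately have "elts \<kappa> \<lesssim> elts \<gamma>" using lepoll_trans by blast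
  then have "elts \<kappa> \<prec> elts \<kappa>" using less lesspoll_trans1 by blast
  then show False by simp
qed

theorem theorem8p4:
  shows "(\<forall>\<eta> \<kappa> :: 'v::set_universe.
            regular_Card \<eta> \<and> uncountable (elts \<eta>) \<and> ord_le \<eta> \<kappa> \<and> tall_closure \<kappa> \<eta> \<longrightarrow>
            (\<exists>\<delta>. is_SULST \<eta> \<delta> \<and> ord_le \<delta> \<kappa>)) \<and>
         (\<forall>\<kappa> :: 'v. tall \<kappa> \<longrightarrow> is_SULST \<kappa> \<kappa> \<and> is_ULST \<kappa> \<kappa>)"
proof (intro conjI allI impI)
  fix \<eta> \<kappa> :: 'v
  assume "regular_Card \<eta> \<and> uncountable (elts \<eta>) \<and> ord_le \<eta> \<kappa> \<and> tall_closure \<kappa> \<eta>"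
  then have S: "SULST_property \<eta> \<kappa>" using SULST_property_of_tall_closure by blast
  have ord: "is_Ord \<delta>" if "SULST_property \<eta> \<delta>" for \<delta>
    using that is_Card_Ord unfolding SULST_property_def by blast
  \<comment> \<open>Foundation yields a \<delta> with no member having the property; linearity of
    the ordinals then makes it the least one, and in particular at most \<kappa>.\<close>
  obtain \<delta> where \<delta>: "SULST_property \<eta> \<delta>" "\<And>z. z \<in> elts \<delta> \<Longrightarrow> \<not> SULST_property \<eta> z"
    using least_elt[of "SULST_property \<eta>" \<kappa>, OF S] by blast
  have "ord_le \<delta> \<delta>'" if "SULST_property \<eta> \<delta>'" for \<delta>'
    using is_Ord_linear[OF ord[OF \<delta>(1)] ord[OF that]] \<delta>(2) that unfolding ord_le_def by blast
  then show "\<exists>\<delta>. is_SULST \<eta> \<delta> \<and> ord_le \<delta> \<kappa>" using \<delta>(1) S unfolding is_SULST_def by blast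
next
  fix \<kappa> :: 'v
  assume "tall \<kappa>"
  then have S: "SULST_property \<kappa> \<kappa>" and "infinite (elts \<kappa>)" "is_Card \<kappa>"
    using SULST_property_of_tall tall_regular unfolding regular_Card_def by blast+
  then show "is_SULST \<kappa> \<kappa>" "is_ULST \<kappa> \<kappa>"
    using ULST_property_imp_ord_le SULST_imp_ULST_property
    unfolding is_SULST_def is_ULST_def by blast+
qed

end
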